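(* Let $n$ be a positive integer. If $n=4$ then $\mathcal{C}(n) = \mathcal{D}(n) \setminus \{10\}$; if $n=5$ then $\mathcal{C}(n) = \mathcal{D}(n) \setminus \{17\}$; and if $n \notin \{4,5\}$ then $\mathcal{C}(n) = \mathcal{D}(n)$.
   Context: A quasigroup is a pair $(Q,* )$ where $Q$ is a non-empty set and $*$ is a binary operation on $Q$ such that for every $(a,b)\in Q^2$ there exists a unique $x \in Q$ with $a*x=b$ and a unique $y\in Q$ with $y*a=b$. Its order is $|Q|$. For a finite quasigroup $Q$ let $\mathcal{C}(Q) = |\{(x,y)\in Q^2 : x*y=y*x\}|$ be the number of ordered commuting pairs. For a positive integer $n$, $\mathcal{C}(n)$ denotes the set of all values $\mathcal{C}(Q)$ as $Q$ ranges over all quasigroups of order $n$, and $\mathcal{D}(n) = \{n, n+2, n+4, \ldots, n^2-6\}\cup\{n^2\}$, where the first set consists of all integers $k\equiv n \bmod 2$ with $n\leq k\leq n^2-6$ (it is empty if $n^2-6<n$). *)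

theory Defs
  imports Main
begin

locale quasigroup =
  fixes Q :: "'a set" and mult :: "'a \<Rightarrow> 'a \<Rightarrow> 'a"  (infixl "\<star>" 70)
  assumes nonempty: "Q \<noteq> {}"
    and closed: "\<lbrakk>a \<in> Q; b \<in> Q\<rbrakk> \<Longrightarrow> a \<star> b \<in> Q"
    and left_div: "\<lbrakk>a \<in> Q; b \<in> Q\<rbrakk> \<Longrightarrow> \<exists>!x. x \<in> Q \<and> a \<star> x = b"
    and right_div: "\<lbrakk>a \<in> Q; b \<in> Q\<rbrakk> \<Longrightarrow> \<exists>!y. y \<in> Q \<and> y \<star> a = b"

definition comm_pairs :: "'a set \<Rightarrow> ('a \<Rightarrow> 'a \<Rightarrow> 'a) \<Rightarrow> nat" where
  "comm_pairs Q mult = card {(x, y). x \<in> Q \<and> y \<in> Q \<and> mult x y = mult y x}"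

text \<open>The carriers range over the sets of natural numbers. Every finite quasigroup is
  isomorphic to one of these, so the choice of type loses no values; see the lemma
  \<open>comm_pairs_in_comm_spectrum\<close> below. For \<open>n > 0\<close> the condition \<open>card Q = n\<close> forces \<open>Q\<close>
  to be finite.\<close>

definition comm_spectrum :: "nat \<Rightarrow> nat set" where
  "comm_spectrum n =
    {comm_pairs Q mult | (Q :: nat set) (mult :: nat \<Rightarrow> nat \<Rightarrow> nat).
       quasigroup Q mult \<and> card Q = n}"

text \<open>The upper bound \<open>k \<le> n\<^sup>2 - 6\<close> is written additively, since subtraction on \<open>nat\<close>
  truncates.\<close>

definition D_set :: "nat \<Rightarrow> nat set" where
  "D_set n = {k. k mod 2 = n mod 2 \<and> n \<le> k \<and> k + 6 \<le> n\<^sup>2} \<union> {n\<^sup>2}"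

lemma comm_pairs_in_comm_spectrum:
  fixes Q :: "'a set"
  assumes "quasigroup Q mult" and fin: "finite Q"
  shows "comm_pairs Q mult \<in> comm_spectrum (card Q)"
proof -
  interpret quasigroup Q mult by fact
  obtain f :: "'a \<Rightarrow> nat" where inj: "inj_on f Q"
    using finite_imp_inj_to_nat_seg[OF fin] by blast
  define g where "g = inv_into Q f"
  have gf [simp]: "g (f x) = x" if "x \<in> Q" for x
    using that inj by (simp add: g_def)
  define m where "m i j = f (mult (g i) (g j))" for i j
  have m [simp]: "m (f x) (f y) = f (mult x y)" if "x \<in> Q" "y \<in> Q" for x y
    using that by (simp add: m_def)
  have f_eq [simp]: "f x = f y \<longleftrightarrow> x = y" if "x \<in> Q" "y \<in> Q" for x y
    using inj that by (auto dest: inj_onD)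
  have q: "quasigroup (f ` Q) m"
  proof
    show "f ` Q \<noteq> {}" using nonempty by simp
  next
    fix i j assume "i \<in> f ` Q" "j \<in> f ` Q"
    then obtain a b where ab: "a \<in> Q" "b \<in> Q" "i = f a" "j = f b" by blast
    show "m i j \<in> f ` Q" using ab closed by simp
    show "\<exists>!k. k \<in> f ` Q \<and> m i k = j"
      using left_div[OF ab(1,2)]
    proof (rule ex1E)
      fix x assume x: "x \<in> Q \<and> mult a x = b"
        and uniq: "\<forall>y. y \<in> Q \<and> mult a y = b \<longrightarrow> y = x"
      show ?thesis
      proof (rule ex1I)
        show "f x \<in> f ` Q \<and> m i (f x) = j"
          using ab x by simp
      next
        fix k assume k: "k \<in> f ` Q \<and> m i k = j"
        then obtain y where y: "y \<in> Q" "k = f y" by blast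
        with k ab have "f (mult a y) = f b" by simp
        with ab y(1) have "mult a y = b" by (simp only: f_eq closed)
        with uniq y show "k = f x" by blast
      qed
    qed
    show "\<exists>!k. k \<in> f ` Q \<and> m k i = j"
      using right_div[OF ab(1,2)]
    proof (rule ex1E)
      fix y assume y: "y \<in> Q \<and> mult y a = b"
        and uniq: "\<forall>z. z \<in> Q \<and> mult z a = b \<longrightarrow> z = y"
      show ?thesis
      proof (rule ex1I)
        show "f y \<in> f ` Q \<and> m (f y) i = j"
          using ab y by simp
      next
        fix k assume k: "k \<in> f ` Q \<and> m k i = j"
        then obtain z where z: "z \<in> Q" "k = f z" by blast
        with k ab have "f (mult z a) = f b" by simp
        with ab z(1) have "mult z a = b" by (simp only: f_eq closed)
        with uniq z show "k = f y" by blast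
      qed
    qed
  qed
  have "{(i, j). i \<in> f ` Q \<and> j \<in> f ` Q \<and> m i j = m j i}
      = map_prod f f ` {(x, y). x \<in> Q \<and> y \<in> Q \<and> mult x y = mult y x}"
    (is "?L = map_prod f f ` ?C")
  proof (intro equalityI subsetI)
    fix p assume "p \<in> ?L"
    then obtain x y where xy: "x \<in> Q" "y \<in> Q" "p = (f x, f y)" "m (f x) (f y) = m (f y) (f x)"
      by blast
    then have "mult x y = mult y x" by (simp add: closed)
    with xy have "(x, y) \<in> ?C" "p = map_prod f f (x, y)" by simp_all
    then show "p \<in> map_prod f f ` ?C" by blast
  next
    fix p assume "p \<in> map_prod f f ` ?C"
    then show "p \<in> ?L" by force
  qed
  moreover have "inj_on (map_prod f f) {(x, y). x \<in> Q \<and> y \<in> Q \<and> mult x y = mult y x}"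
    by (auto simp: inj_on_def)
  ultimately have "comm_pairs (f ` Q) m = comm_pairs Q mult"
    by (simp add: comm_pairs_def card_image)
  moreover have "card (f ` Q) = card Q"
    using inj by (rule card_image)
  ultimately show ?thesis
    unfolding comm_spectrum_def using q by (intro CollectI exI[of _ "f ` Q"] exI[of _ m]) simp
qed

end

theory Submission
  imports Defs "HOL-Combinatorics.Transposition"
begin

text \<open>A quasigroup of order \<open>n\<close> with \<open>k\<close> commuting pairs has \<open>n\<^sup>2 - k\<close> ordered non-commuting pairs.

  Upper bound. The number \<open>n\<^sup>2 - k\<close> is even, and \<open>k \<ge> n\<close> because of the diagonal. Row \<open>x\<close> and column
  \<open>x\<close> are permutations that agree at the elements commuting with \<open>x\<close>, so they cannot differ in
  exactly one place: an element has no non-commuting partner or at least two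
  (\<open>card_noncomm_ne_1\<close>). Hence \<open>n\<^sup>2 - k\<close> is \<open>0\<close> or at least \<open>6\<close>. In the two exceptional cases all
  elements but one would have exactly two partners, and the one symbol \<open>v \<star> v\<close> at the remaining
  element \<open>v\<close> would have to be two symbols at once (\<open>noncomm_not_all_but_one\<close>).

  Realization. A table of order \<open>s + t\<close> is put together from a subsquare of order \<open>s\<close>, a square of
  order \<open>t\<close>, and two cyclic borders of size \<open>s \<times> t\<close> and \<open>t \<times> s\<close> (\<open>bordered\<close>, \<open>hollow_spectrum\<close>).
  The commuting pairs of the subsquare and of the square add up, and every place where the two
  borders agree contributes two more. Permuting the rows of one border against the columns of the
  other varies the agreement in steps of \<open>t\<close> places, while the subsquare, by induction on the
  order, contributes any value in \<open>D_set s\<close>. Apart from \<open>s\<^sup>2\<close> these form an interval of one parity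
  whose length grows like \<open>s\<^sup>2\<close>, so the values for different agreements overlap (\<open>window_cover\<close>), and
  it suffices to have one square of order \<open>t\<close> with few commuting cells and one with many. No
  permutation moves exactly one row; for the largest values in odd order the resulting gap is
  closed by exchanging two rows inside \<open>2 \<times> 2\<close> subsquares of a border (\<open>hollow_switched_spectrum\<close>).

  For even order \<open>2 * s\<close> one takes \<open>t = s\<close> and any quasigroup as the square
  (\<open>doubling_spectrum\<close>). For odd order, \<open>t\<close> exceeds \<open>s\<close> by one or three, and the square contains, besides
  the symbols of the subsquare, one or three residues in each row and column. Small values come
  from circulant squares in which only the diagonal commutes (\<open>low_values_1\<close>, \<open>low_values_3\<close>).
  Large values need odd \<open>s\<close> and even \<open>t\<close> and come from symmetric squares: the symbols of the
  subsquare are the colours of a one-factorization of the complete graph on \<open>t\<close> vertices. If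
  \<open>t = s + 3\<close>, two colours are spared; their union is a Hamiltonian cycle, along which the
  residues can be written down explicitly (\<open>matching_filling\<close>, \<open>cycle_filling\<close>).

  The orders from \<open>3\<close> to \<open>7\<close> and \<open>9\<close>, and isolated values for the orders \<open>8\<close>, \<open>10\<close> and \<open>11\<close>, are
  settled by explicit tables.\<close>

section \<open>Which values are impossible\<close>

lemma quasigroup_cancel:
  assumes "quasigroup Q m" "a \<in> Q" "x \<in> Q" "y \<in> Q"
  shows "m a x = m a y \<longleftrightarrow> x = y" "m x a = m y a \<longleftrightarrow> x = y"
proof -
  interpret quasigroup Q m by fact
  show "m a x = m a y \<longleftrightarrow> x = y"
    using left_div[OF assms(2) closed[OF assms(2,3)]] assms by metis
  show "m x a = m y a \<longleftrightarrow> x = y"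
    using right_div[OF assms(2) closed[OF assms(3,2)]] assms by metis
qed

definition noncomm :: "'a set \<Rightarrow> ('a \<Rightarrow> 'a \<Rightarrow> 'a) \<Rightarrow> 'a \<Rightarrow> 'a set" where
  "noncomm Q m x = {y \<in> Q. m x y \<noteq> m y x}"

lemma noncomm_sym: "x \<in> Q \<Longrightarrow> y \<in> noncomm Q m x \<Longrightarrow> x \<in> noncomm Q m y"
  by (auto simp: noncomm_def)

text \<open>Row \<open>x\<close> and column \<open>x\<close> are permutations of \<open>Q\<close> that agree at every element commuting with
  \<open>x\<close>, so the symbols left over for the other positions are the same.\<close>

lemma row_image_noncomm:
  assumes q: "quasigroup Q m" and x: "x \<in> Q"
  shows "(\<lambda>y. m x y) ` noncomm Q m x = (\<lambda>y. m y x) ` noncomm Q m x"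
proof -
  interpret quasigroup Q m by fact
  have *: "f ` noncomm Q m x = Q - f ` (Q - noncomm Q m x)"
    if "inj_on f Q" "f ` Q = Q" for f
  proof -
    have "f ` (Q - (Q - noncomm Q m x)) = f ` Q - f ` (Q - noncomm Q m x)"
      by (rule inj_on_image_set_diff[OF that(1)]) auto
    moreover have "Q - (Q - noncomm Q m x) = noncomm Q m x" by (auto simp: noncomm_def)
    ultimately show ?thesis using that(2) by simp
  qed
  have "(\<lambda>y. m x y) ` Q = Q"
  proof (intro equalityI subsetI)
    fix b assume "b \<in> Q"
    from left_div[OF x this] show "b \<in> (\<lambda>y. m x y) ` Q" by blast
  qed (use x closed in auto)
  moreover have "(\<lambda>y. m y x) ` Q = Q"
  proof (intro equalityI subsetI)
    fix b assume "b \<in> Q"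
    from right_div[OF x this] show "b \<in> (\<lambda>y. m y x) ` Q" by blast
  qed (use x closed in auto)
  moreover have "inj_on (\<lambda>y. m x y) Q" "inj_on (\<lambda>y. m y x) Q"
    using quasigroup_cancel[OF q x] by (auto simp: inj_on_def)
  moreover have "(\<lambda>y. m x y) ` (Q - noncomm Q m x) = (\<lambda>y. m y x) ` (Q - noncomm Q m x)"
    by (auto simp: noncomm_def image_iff)
  ultimately show ?thesis by (simp add: *)
qed

lemma card_noncomm_ne_1:
  assumes "quasigroup Q m" "x \<in> Q"
  shows "card (noncomm Q m x) \<noteq> 1"
proof
  assume "card (noncomm Q m x) = 1"
  then obtain y where y: "noncomm Q m x = {y}" by (auto simp: card_1_singleton_iff)
  with row_image_noncomm[OF assms] have "m x y = m y x" by simp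
  with y show False by (auto simp: noncomm_def)
qed

text \<open>With two partners, the two symbols left over stand in column \<open>x\<close> in the opposite order.\<close>

lemma two_noncomm_swap:
  assumes q: "quasigroup Q m" "x \<in> Q" and N: "noncomm Q m x = {y, z}"
  shows "m x z = m y x" "m x y = m z x"
proof -
  have "{m x y, m x z} = {m y x, m z x}"
    using row_image_noncomm[OF q] by (simp add: N)
  moreover have "m x y \<noteq> m y x" "m x z \<noteq> m z x" using N by (auto simp: noncomm_def)
  ultimately show "m x z = m y x" "m x y = m z x" by (auto simp: doubleton_eq_iff)
qed

lemma comm_pairs_eq_sum:
  assumes "finite Q"
  shows "comm_pairs Q m + (\<Sum>x\<in>Q. card (noncomm Q m x)) = (card Q)\<^sup>2"
proof -
  let ?C = "{(x, y). x \<in> Q \<and> y \<in> Q \<and> m x y = m y x}"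
  have eq: "Q \<times> Q = ?C \<union> Sigma Q (noncomm Q m)" by (auto simp: noncomm_def)
  have "finite ?C" by (rule finite_subset[of _ "Q \<times> Q"]) (use assms in auto)
  moreover have fin: "finite (noncomm Q m x)" for x using assms by (simp add: noncomm_def)
  ultimately have "card (Q \<times> Q) = card ?C + card (Sigma Q (noncomm Q m))"
    unfolding eq by (intro card_Un_disjoint) (use assms in \<open>auto simp: noncomm_def\<close>)
  with assms fin show ?thesis
    by (simp add: comm_pairs_def card_cartesian_product power2_eq_square)
qed

text \<open>Transposition pairs off the non-commuting ordered pairs; the order of the natural numbers
  picks one from each pair.\<close>

lemma even_sum_noncomm:
  fixes Q :: "nat set"
  assumes "finite Q"
  shows "even (\<Sum>x\<in>Q. card (noncomm Q m x))"
proof -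
  let ?L = "{(x, y). x \<in> Q \<and> y \<in> noncomm Q m x \<and> x < y}"
  let ?G = "{(x, y). x \<in> Q \<and> y \<in> noncomm Q m x \<and> y < x}"
  have fin: "finite (noncomm Q m x)" for x using assms by (simp add: noncomm_def)
  have S: "finite (Sigma Q (noncomm Q m))" using assms fin by auto
  have "finite ?L" "finite ?G" by (rule finite_subset[OF _ S]; auto)+
  moreover have "Sigma Q (noncomm Q m) = ?L \<union> ?G"
    by (auto simp: noncomm_def) (metis linorder_neqE_nat)
  moreover have "?L \<inter> ?G = {}" by auto
  ultimately have "card (Sigma Q (noncomm Q m)) = card ?L + card ?G"
    by (simp add: card_Un_disjoint)
  moreover have "?G = prod.swap ` ?L" by (force simp: noncomm_def image_iff)
  then have "card ?G = card ?L" by (simp add: card_image)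
  ultimately have "card (Sigma Q (noncomm Q m)) = 2 * card ?L" by simp
  with assms fin show ?thesis by simp
qed

text \<open>An element with a non-commuting partner has two of them, and each of the two again has at
  least two partners: three elements contribute at least two each.\<close>

lemma sum_noncomm_ge_6:
  assumes q: "quasigroup Q m" and fin: "finite Q"
    and ne: "(\<Sum>x\<in>Q. card (noncomm Q m x)) \<noteq> 0"
  shows "(\<Sum>x\<in>Q. card (noncomm Q m x)) \<ge> 6"
proof -
  have finN: "finite (noncomm Q m x)" for x using fin by (simp add: noncomm_def)
  have two: "card (noncomm Q m x) \<ge> 2" if "x \<in> Q" "noncomm Q m x \<noteq> {}" for x
    using card_noncomm_ne_1[OF q that(1)] that finN[of x]
    by (metis One_nat_def Suc_1 Suc_leI card_gt_0_iff le_neq_implies_less)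
  obtain x where x: "x \<in> Q" "noncomm Q m x \<noteq> {}"
    using ne by (metis card.empty sum.neutral)
  obtain A where "A \<subseteq> noncomm Q m x" "card A = 2"
    using obtain_subset_with_card_n[OF two[OF x]] by metis
  then obtain y z where yz: "y \<in> noncomm Q m x" "z \<in> noncomm Q m x" "y \<noteq> z"
    unfolding card_2_iff by blast
  then have xyz: "y \<in> Q" "z \<in> Q" "x \<noteq> y" "x \<noteq> z" by (auto simp: noncomm_def)
  have "x \<in> noncomm Q m y" "x \<in> noncomm Q m z" using yz x noncomm_sym by metis+
  then have "card (noncomm Q m x) \<ge> 2" "card (noncomm Q m y) \<ge> 2" "card (noncomm Q m z) \<ge> 2"
    using x xyz two by blast+
  then have "6 \<le> (\<Sum>v\<in>{x, y, z}. card (noncomm Q m v))"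
    using xyz yz by simp
  also have "\<dots> \<le> (\<Sum>v\<in>Q. card (noncomm Q m v))"
    by (rule sum_mono2) (use fin x xyz in auto)
  finally show ?thesis .
qed

text \<open>The hypothesis describes \<open>10\<close> commuting pairs in order \<open>4\<close> and \<open>17\<close> in order \<open>5\<close>. Every
  element of the set \<open>V\<close> of non-central elements has at least two partners, all in \<open>V\<close>; the sum
  therefore leaves only the possibility that a single element \<open>v\<close> is central and each element of
  \<open>V\<close> has exactly two partners. By \<open>two_noncomm_swap\<close> the two products \<open>x \<star> y\<close>, \<open>y \<star> x\<close> are the
  symbols that both \<open>x\<close> and \<open>y\<close> have at their non-commuting positions. This pair of symbols
  \<open>{p, q'}\<close> is common to all of \<open>V\<close>, since with at most four elements two non-adjacent ones have
  a common partner. If \<open>v \<star> u\<close> were \<open>p\<close> for some \<open>u\<close> in \<open>V\<close>, then row \<open>u\<close> would contain \<open>p\<close> both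
  at \<open>v\<close> and at a partner of \<open>u\<close>. So \<open>p\<close> stands in row \<open>v\<close> on the diagonal, and so does \<open>q'\<close>.\<close>

lemma noncomm_not_all_but_one:
  assumes q: "quasigroup Q m" and fin: "finite Q"
    and sum: "(\<Sum>x\<in>Q. card (noncomm Q m x)) = 2 * (card Q - 1)" and card: "card Q \<in> {4, 5}"
  shows False
proof -
  interpret quasigroup Q m by fact
  let ?N = "noncomm Q m"
  define V where "V = {x \<in> Q. ?N x \<noteq> {}}"
  have finN: "finite (?N x)" for x using fin by (simp add: noncomm_def)
  have VQ: "V \<subseteq> Q" and finV: "finite V" using fin by (auto simp: V_def)
  have two: "card (?N x) \<ge> 2" if "x \<in> V" for x
    using card_noncomm_ne_1[OF q, of x] that finN[of x] unfolding V_def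
    by (metis (mono_tags, lifting) One_nat_def Suc_1 Suc_leI card_gt_0_iff le_neq_implies_less mem_Collect_eq)
  have sumV: "(\<Sum>x\<in>V. card (?N x)) = 2 * (card Q - 1)"
    unfolding sum[symmetric] by (rule sum.mono_neutral_left) (use fin in \<open>auto simp: V_def\<close>)
  have NV: "?N x \<subseteq> V - {x}" if "x \<in> V" for x
    using that noncomm_sym[of x Q _ m] by (fastforce simp: V_def noncomm_def)
  have up: "card (?N x) \<le> card V - 1" if "x \<in> V" for x
    using card_mono[OF _ NV[OF that]] that finV by simp
  have c1: "2 * card V \<le> 2 * (card Q - 1)"
    using sum_mono[of V "\<lambda>_. 2" "\<lambda>x. card (?N x)"] two sumV by simp
  have c2: "2 * (card Q - 1) \<le> card V * (card V - 1)"
    using sum_mono[of V "\<lambda>x. card (?N x)" "\<lambda>_. card V - 1"] up sumV by simp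
  have cardV: "card V = card Q - 1"
  proof (rule antisym)
    show "card V \<le> card Q - 1" using c1 by simp
    show "card Q - 1 \<le> card V"
    proof (rule ccontr)
      assume "\<not> card Q - 1 \<le> card V"
      then have "card V * (card V - 1) \<le> (card Q - 2) * (card Q - 3)"
        by (intro mult_mono) auto
      with c2 card show False by auto
    qed
  qed
  have deg: "card (?N x) = 2" if "x \<in> V" for x
  proof (rule ccontr)
    assume "card (?N x) \<noteq> 2"
    then have "(\<Sum>x\<in>V. 2) < (\<Sum>x\<in>V. card (?N x))"
      using two that finV by (intro sum_strict_mono_ex1) (auto intro!: bexI[of _ x] simp: le_less)
    with sumV cardV show False by simp
  qed
  have "card (Q - V) = 1"
    using cardV card card_Diff_subset[OF finV VQ] by auto
  then obtain v where v: "Q - V = {v}" by (auto simp: card_1_singleton_iff)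
  then have vQ: "v \<in> Q" "v \<notin> V" and Qv: "Q = insert v V" using VQ by auto
  have "V \<noteq> {}" using cardV card by auto
  then obtain x where x: "x \<in> V" by blast
  define S where "S w = m w ` ?N w" for w
  have pair: "\<exists>c. ?N a = {b, c}" if "a \<in> V" "b \<in> ?N a" for a b
    using deg[OF that(1)] that(2) unfolding card_2_iff by (metis insert_commute insertE singletonD)
  have edge: "S b = {m a b, m b a}" "S a = {m a b, m b a}" if ab: "a \<in> V" "b \<in> ?N a" for a b
  proof -
    have aQ: "a \<in> Q" and bV: "b \<in> V" and bQ: "b \<in> Q" and ba: "a \<in> ?N b"
      using ab NV[OF ab(1)] VQ noncomm_sym[of a Q b m] by auto
    obtain c where c: "?N a = {b, c}" using pair[OF ab] by blast
    obtain d where d: "?N b = {a, d}" using pair[OF bV ba] by blast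
    show "S b = {m a b, m b a}" "S a = {m a b, m b a}"
      using two_noncomm_swap(1)[OF q aQ c] two_noncomm_swap(1)[OF q bQ d]
      by (simp_all add: S_def c d insert_commute)
  qed
  obtain y where y: "y \<in> ?N x" using x by (auto simp: V_def)
  define p q' where "p = m x y" and "q' = m y x"
  have xQ: "x \<in> Q" and yV: "y \<in> V" using x y VQ NV[OF x] by auto
  have pq: "p \<noteq> q'" using y by (auto simp: p_def q'_def noncomm_def)
  have Sx: "S x = {p, q'}" using edge(2)[OF x y] by (simp add: p_def q'_def)
  have S: "S w = {p, q'}" if w: "w \<in> V" for w
  proof -
    consider "w = x" | "w \<in> ?N x" | "w \<noteq> x" "w \<notin> ?N x" by blast
    then show ?thesis
    proof cases
      case 2
      from edge[OF x 2] Sx show ?thesis by simp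
    next
      case 3
      then have "x \<notin> ?N w" using noncomm_sym[of w Q x m] w VQ by auto
      have "card (V - {x, w}) \<le> 2"
        using 3 w x cardV card finV by (auto simp: card_Diff_subset)
      moreover have "?N w \<subseteq> V - {x, w}" "?N x \<subseteq> V - {x, w}"
        using NV[OF w] NV[OF x] \<open>x \<notin> ?N w\<close> 3 by auto
      ultimately have "?N w = V - {x, w}" "?N x = V - {x, w}"
        using deg[OF w] deg[OF x] finV by (intro card_seteq; simp)+
      then have "y \<in> ?N w" using y by simp
      from edge[OF w this] edge[OF x y] Sx show ?thesis by simp
    qed (use Sx in simp)
  qed
  have "m v v = r" if r: "r \<in> {p, q'}" for r
  proof -
    have "p \<in> Q" "q' \<in> Q" using closed xQ yV VQ by (auto simp: p_def q'_def)
    then obtain u where u: "u \<in> Q" "m v u = r" using left_div[OF vQ(1), of r] r by auto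
    have "u \<notin> V"
    proof
      assume uV: "u \<in> V"
      have "v \<notin> ?N u" using NV[OF uV] vQ by auto
      then have "m u v = r" using u vQ by (auto simp: noncomm_def)
      moreover from r have "r \<in> m u ` ?N u" unfolding S[OF uV, symmetric] S_def .
      then obtain w where "w \<in> ?N u" "m u w = r" by blast
      ultimately show False
        using quasigroup_cancel(1)[OF q u(1) vQ(1), of w] \<open>v \<notin> ?N u\<close> by (auto simp: noncomm_def)
    qed
    with u Qv show ?thesis by auto
  qed
  from this[of p] this[of q'] pq show False by simp
qed

lemma comm_spectrum_upper:
  assumes n: "n > 0" and k: "k \<in> comm_spectrum n"
  shows "k \<in> D_set n" "\<not> (n = 4 \<and> k = 10)" "\<not> (n = 5 \<and> k = 17)"
proof -
  from k obtain Q :: "nat set" and m where q: "quasigroup Q m" and cQ: "card Q = n"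
    and kQ: "k = comm_pairs Q m" by (auto simp: comm_spectrum_def)
  have fin: "finite Q" using n cQ card_ge_0_finite by metis
  let ?s = "\<Sum>x\<in>Q. card (noncomm Q m x)"
  have sum: "k + ?s = n\<^sup>2" using comm_pairs_eq_sum[OF fin, of m] cQ kQ by simp
  have "card ((\<lambda>x. (x, x)) ` Q) \<le> k"
    unfolding kQ comm_pairs_def
    by (rule card_mono) (auto intro: finite_subset[of _ "Q \<times> Q"] simp: fin)
  then have nk: "n \<le> k" by (simp add: card_image inj_on_def cQ)
  obtain r where r: "?s = 2 * r" using even_sum_noncomm[OF fin] by blast
  have "k mod 2 = (k + 2 * r) mod 2" by simp
  also have "\<dots> = n mod 2" using sum r by (simp add: power2_eq_square mod2_eq_if)
  finally have par: "k mod 2 = n mod 2" .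
  show "k \<in> D_set n"
  proof (cases "?s = 0")
    case True
    with sum show ?thesis by (simp add: D_set_def)
  next
    case False
    from sum_noncomm_ge_6[OF q fin False] nk par sum show ?thesis by (auto simp: D_set_def)
  qed
  show "\<not> (n = 4 \<and> k = 10)" "\<not> (n = 5 \<and> k = 17)"
    using noncomm_not_all_but_one[OF q fin] sum cQ by (auto simp: power2_eq_square)
qed

section \<open>The bordered construction\<close>

lemma finite_quasigroupI:
  assumes fin: "finite Q" and ne: "Q \<noteq> {}"
    and closed: "\<And>a b. a \<in> Q \<Longrightarrow> b \<in> Q \<Longrightarrow> m a b \<in> Q"
    and left: "\<And>a. a \<in> Q \<Longrightarrow> inj_on (m a) Q"
    and right: "\<And>a. a \<in> Q \<Longrightarrow> inj_on (\<lambda>x. m x a) Q"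
  shows "quasigroup Q m"
proof -
  have *: "\<exists>!x. x \<in> Q \<and> f x = b" if "inj_on f Q" "f ` Q \<subseteq> Q" "b \<in> Q" for f b
  proof -
    have "f ` Q = Q" by (rule endo_inj_surj[OF fin that(2,1)])
    then have "b \<in> f ` Q" using that(3) by simp
    then obtain x where "x \<in> Q" "f x = b" by blast
    with that(1) show ?thesis by (intro ex1I[of _ x]) (auto dest: inj_onD)
  qed
  show ?thesis
  proof
    fix a b assume ab: "a \<in> Q" "b \<in> Q"
    show "\<exists>!x. x \<in> Q \<and> m a x = b"
      by (rule *[OF left[OF ab(1)] _ ab(2)]) (use closed ab in auto)
    show "\<exists>!x. x \<in> Q \<and> m x a = b"
      by (rule *[OF right[OF ab(1)] _ ab(2)]) (use closed ab in auto)
  qed (use ne closed in auto)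
qed

text \<open>Used to give the subsquare of the bordered construction the labels of the border rows as its
  elements.\<close>

lemma quasigroup_on_set:
  fixes R :: "'b set"
  assumes k: "k \<in> comm_spectrum (card R)" and fin: "finite R" and ne: "R \<noteq> {}"
  obtains m where "quasigroup R m" "comm_pairs R m = k"
proof -
  from k obtain Q :: "nat set" and m where q: "quasigroup Q m" and cQ: "card Q = card R"
    and kQ: "k = comm_pairs Q m" by (auto simp: comm_spectrum_def)
  interpret quasigroup Q m by fact
  have finQ: "finite Q" using cQ fin ne by (metis card_gt_0_iff)
  obtain f where f: "bij_betw f Q R" using finite_same_card_bij[OF finQ fin cQ] by blast
  define g where "g = inv_into Q f"
  have gQ: "g b \<in> Q" "f (g b) = b" if "b \<in> R" for b
    using f that by (auto simp: g_def bij_betw_def inv_into_into f_inv_into_f)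
  have fR: "f a \<in> R" "g (f a) = a" if "a \<in> Q" for a
    using f that by (auto simp: g_def bij_betw_def)
  have f_eq: "f a = f b \<longleftrightarrow> a = b" if "a \<in> Q" "b \<in> Q" for a b
    using f that by (auto simp: bij_betw_def inj_on_def)
  define m' where "m' i j = f (m (g i) (g j))" for i j
  have "quasigroup R m'"
  proof (rule finite_quasigroupI[OF fin ne])
    fix a assume a: "a \<in> R"
    show "inj_on (m' a) R"
      by (rule inj_onI) (metis a m'_def gQ f_eq closed quasigroup_cancel(1)[OF q])
    show "inj_on (\<lambda>x. m' x a) R"
      by (rule inj_onI) (metis a m'_def gQ f_eq closed quasigroup_cancel(2)[OF q])
  qed (auto simp: m'_def gQ fR closed)
  moreover have "comm_pairs R m' = k"
  proof -
    have "{(x, y). x \<in> R \<and> y \<in> R \<and> m' x y = m' y x}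
        = map_prod f f ` {(x, y). x \<in> Q \<and> y \<in> Q \<and> m x y = m y x}"
    proof (intro equalityI subsetI)
      fix p assume "p \<in> {(x, y). x \<in> R \<and> y \<in> R \<and> m' x y = m' y x}"
      then obtain x y where p: "p = (x, y)" "x \<in> R" "y \<in> R" "m' x y = m' y x" by blast
      then have "m (g x) (g y) = m (g y) (g x)" by (simp add: m'_def f_eq gQ closed)
      with p show "p \<in> map_prod f f ` {(x, y). x \<in> Q \<and> y \<in> Q \<and> m x y = m y x}"
        by (intro image_eqI[of _ _ "(g x, g y)"]) (auto simp: gQ)
    qed (auto simp: m'_def fR)
    moreover have "inj_on (map_prod f f) {(x, y). x \<in> Q \<and> y \<in> Q \<and> m x y = m y x}"
      by (auto simp: inj_on_def f_eq)
    ultimately show ?thesis by (simp add: kQ comm_pairs_def card_image)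
  qed
  ultimately show ?thesis by (rule that)
qed

text \<open>The count of commuting pairs for a square array whose symbols need not be its row labels.\<close>

definition sym_cells :: "'a set \<Rightarrow> ('a \<Rightarrow> 'a \<Rightarrow> 'b) \<Rightarrow> nat" where
  "sym_cells C P = card {(x, y). x \<in> C \<and> y \<in> C \<and> P x y = P y x}"

text \<open>A multiplication table on the disjoint union of \<open>A\<close> and \<open>C\<close>, cut into the subsquare \<open>m\<close> on
  \<open>A\<close>, the array \<open>P\<close> on \<open>C\<close>, and the borders: \<open>U\<close> holds the rows labelled by \<open>A\<close>, \<open>V\<close> the columns
  labelled by \<open>A\<close>, both filled with symbols of \<open>C\<close>.\<close>

definition bordered ::
  "('a \<Rightarrow> 'a \<Rightarrow> 'a) \<Rightarrow> ('a \<Rightarrow> 'b \<Rightarrow> 'b) \<Rightarrow> ('b \<Rightarrow> 'a \<Rightarrow> 'b) \<Rightarrow> ('b \<Rightarrow> 'b \<Rightarrow> 'a + 'b)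
    \<Rightarrow> 'a + 'b \<Rightarrow> 'a + 'b \<Rightarrow> 'a + 'b" where
  "bordered m U V P u v =
    (case u of
       Inl a \<Rightarrow> (case v of Inl b \<Rightarrow> Inl (m a b) | Inr y \<Rightarrow> Inr (U a y))
     | Inr x \<Rightarrow> (case v of Inl b \<Rightarrow> Inr (V x b) | Inr y \<Rightarrow> P x y))"

lemma bordered_simps [simp]:
  "bordered m U V P (Inl a) (Inl b) = Inl (m a b)"
  "bordered m U V P (Inl a) (Inr y) = Inr (U a y)"
  "bordered m U V P (Inr x) (Inl b) = Inr (V x b)"
  "bordered m U V P (Inr x) (Inr y) = P x y"
  by (simp_all add: bordered_def)

lemma comm_pairs_bordered:
  fixes m :: "'a \<Rightarrow> 'a \<Rightarrow> 'a" and P :: "'b \<Rightarrow> 'b \<Rightarrow> 'a + 'b"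
  assumes "finite A" "finite C"
  shows "comm_pairs (A <+> C) (bordered m U V P)
    = comm_pairs A m + sym_cells C P + 2 * card {(a, x). a \<in> A \<and> x \<in> C \<and> U a x = V x a}"
proof -
  define X where "X = {(x, y). x \<in> A \<and> y \<in> A \<and> m x y = m y x}"
  define Y where "Y = {(x, y). x \<in> C \<and> y \<in> C \<and> P x y = P y x}"
  define E where "E = {(a, x). a \<in> A \<and> x \<in> C \<and> U a x = V x a}"
  let ?b = "bordered m U V P"
  let ?i = "map_prod Inl Inl :: _ \<Rightarrow> ('a + 'b) \<times> ('a + 'b)"
  let ?j = "map_prod Inr Inr :: _ \<Rightarrow> ('a + 'b) \<times> ('a + 'b)"
  let ?k = "map_prod Inl Inr :: _ \<Rightarrow> ('a + 'b) \<times> ('a + 'b)"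
  let ?l = "\<lambda>(a, x). (Inr x, Inl a) :: ('a + 'b) \<times> ('a + 'b)"
  have "X \<subseteq> A \<times> A" "Y \<subseteq> C \<times> C" "E \<subseteq> A \<times> C" by (auto simp: X_def Y_def E_def)
  then have fin: "finite X" "finite Y" "finite E"
    using assms by (metis finite_subset finite_cartesian_product)+
  have "{(u, v). u \<in> A <+> C \<and> v \<in> A <+> C \<and> ?b u v = ?b v u}
      = (?i ` X \<union> ?j ` Y) \<union> (?k ` E \<union> ?l ` E)" (is "?S = _")
  proof (intro equalityI subsetI)
    fix w assume "w \<in> ?S"
    then obtain u v where w: "w = (u, v)" "u \<in> A <+> C" "v \<in> A <+> C" "?b u v = ?b v u" by blast
    show "w \<in> (?i ` X \<union> ?j ` Y) \<union> (?k ` E \<union> ?l ` E)"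
      using w by (cases u; cases v) (auto simp: image_iff X_def Y_def E_def)
  qed (auto simp: X_def Y_def E_def)
  also have "card \<dots> = card (?i ` X \<union> ?j ` Y) + card (?k ` E \<union> ?l ` E)"
    by (rule card_Un_disjoint) (auto simp: fin)
  also have "card (?i ` X \<union> ?j ` Y) = card (?i ` X) + card (?j ` Y)"
    by (rule card_Un_disjoint) (auto simp: fin)
  also have "card (?k ` E \<union> ?l ` E) = card (?k ` E) + card (?l ` E)"
    by (rule card_Un_disjoint) (auto simp: fin)
  also have "card (?i ` X) = card X" by (rule card_image) (auto simp: inj_on_def)
  also have "card (?j ` Y) = card Y" by (rule card_image) (auto simp: inj_on_def)
  also have "card (?k ` E) = card E" by (rule card_image) (auto simp: inj_on_def)
  also have "card (?l ` E) = card E" by (rule card_image) (auto simp: inj_on_def)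
  finally show ?thesis by (simp add: comm_pairs_def sym_cells_def X_def Y_def E_def)
qed

lemma quasigroup_bordered:
  assumes q: "quasigroup A m" and fin: "finite A" "finite C"
    and P: "\<And>x y. x \<in> C \<Longrightarrow> y \<in> C \<Longrightarrow> P x y \<in> A <+> C"
    and Prow: "\<And>x. x \<in> C \<Longrightarrow> inj_on (P x) C"
    and Pcol: "\<And>y. y \<in> C \<Longrightarrow> inj_on (\<lambda>x. P x y) C"
    and U: "\<And>a x. a \<in> A \<Longrightarrow> x \<in> C \<Longrightarrow> U a x \<in> C"
    and Urow: "\<And>a. a \<in> A \<Longrightarrow> inj_on (U a) C"
    and Ucol: "\<And>x. x \<in> C \<Longrightarrow> inj_on (\<lambda>a. U a x) A"
    and V: "\<And>a x. a \<in> A \<Longrightarrow> x \<in> C \<Longrightarrow> V x a \<in> C"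
    and Vrow: "\<And>x. x \<in> C \<Longrightarrow> inj_on (V x) A"
    and Vcol: "\<And>a. a \<in> A \<Longrightarrow> inj_on (\<lambda>x. V x a) C"
    and PV: "\<And>x y a. x \<in> C \<Longrightarrow> y \<in> C \<Longrightarrow> a \<in> A \<Longrightarrow> P x y \<noteq> Inr (V x a)"
    and PU: "\<And>x y a. x \<in> C \<Longrightarrow> y \<in> C \<Longrightarrow> a \<in> A \<Longrightarrow> P x y \<noteq> Inr (U a y)"
  shows "quasigroup (A <+> C) (bordered m U V P)"
proof -
  interpret quasigroup A m by fact
  show ?thesis
  proof (rule finite_quasigroupI)
    fix u v assume "u \<in> A <+> C" "v \<in> A <+> C"
    then show "bordered m U V P u v \<in> A <+> C"
      by (cases u; cases v) (auto simp: closed U V P)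
  next
    fix u assume u: "u \<in> A <+> C"
    show "inj_on (bordered m U V P u) (A <+> C)"
    proof (rule inj_onI)
      fix v w assume *: "v \<in> A <+> C" "w \<in> A <+> C"
        "bordered m U V P u v = bordered m U V P u w"
      then show "v = w" using u
        by (cases u; cases v; cases w)
           (auto simp: quasigroup_cancel[OF q] PV PV[symmetric]
              dest: inj_onD[OF Urow] inj_onD[OF Vrow] inj_onD[OF Prow])
    qed
    show "inj_on (\<lambda>v. bordered m U V P v u) (A <+> C)"
    proof (rule inj_onI)
      fix v w assume *: "v \<in> A <+> C" "w \<in> A <+> C"
        "bordered m U V P v u = bordered m U V P w u"
      then show "v = w" using u
        by (cases u; cases v; cases w)
           (auto simp: quasigroup_cancel[OF q] PU PU[symmetric]
              dest: inj_onD[OF Ucol] inj_onD[OF Vcol] inj_onD[OF Pcol])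
    qed
  qed (use fin nonempty in auto)
qed

definition residues :: "nat \<Rightarrow> int set" where
  "residues t = {0..<int t}"

lemma finite_residues [simp]: "finite (residues t)" and card_residues [simp]: "card (residues t) = t"
  by (simp_all add: residues_def)

lemma mod_in_residues [simp]: "t > 0 \<Longrightarrow> x mod int t \<in> residues t"
  by (simp add: residues_def)

lemma residues_mod [simp]: "x \<in> residues t \<Longrightarrow> x mod int t = x"
  by (simp add: residues_def)

lemma add_mod_eq_iff: "(x + a) mod t = (x + b) mod t \<longleftrightarrow> a mod t = b mod (t::int)"
  "(a + x) mod t = (b + x) mod t \<longleftrightarrow> a mod t = b mod (t::int)"
  by (simp_all add: mod_eq_dvd_iff)

text \<open>The cyclic instance, with \<open>C\<close> the residues modulo \<open>t\<close>. The last two clauses keep the symbols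
  \<open>x + a\<close> out of row \<open>x\<close> and the symbols \<open>y + g\<close> out of column \<open>y\<close>: these are the symbols that the
  borders will use there.\<close>

definition hollow :: "nat \<Rightarrow> int set \<Rightarrow> int set \<Rightarrow> (int \<Rightarrow> int \<Rightarrow> int + int) \<Rightarrow> bool" where
  "hollow t A G P \<longleftrightarrow>
    (\<forall>x\<in>residues t. \<forall>y\<in>residues t. P x y \<in> A <+> residues t) \<and>
    (\<forall>x\<in>residues t. inj_on (P x) (residues t)) \<and>
    (\<forall>y\<in>residues t. inj_on (\<lambda>x. P x y) (residues t)) \<and>
    (\<forall>x\<in>residues t. \<forall>y\<in>residues t. \<forall>a\<in>A. P x y \<noteq> Inr ((x + a) mod int t)) \<and>
    (\<forall>x\<in>residues t. \<forall>y\<in>residues t. \<forall>g\<in>G. P x y \<noteq> Inr ((y + g) mod int t))"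

text \<open>Border column \<open>a\<close> has the entry \<open>x + a\<close> in row \<open>x\<close>, border row \<open>a\<close> the entry \<open>y + \<gamma> y a\<close> in
  column \<open>y\<close>, so the borders agree where \<open>\<gamma>\<close> fixes \<open>a\<close>.\<close>

lemma hollow_spectrum:
  assumes h: "hollow t A G P" and t: "t > 0" and A: "A \<subseteq> residues t" "A \<noteq> {}" and G: "G \<subseteq> residues t"
    and c: "c \<in> comm_spectrum (card A)"
    and \<gamma>: "\<And>y a. y \<in> residues t \<Longrightarrow> a \<in> A \<Longrightarrow> \<gamma> y a \<in> G"
    and inj: "\<And>y. y \<in> residues t \<Longrightarrow> inj_on (\<gamma> y) A"
    and col: "\<And>a. a \<in> A \<Longrightarrow> inj_on (\<lambda>y. (y + \<gamma> y a) mod int t) (residues t)"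
  shows "c + sym_cells (residues t) P
    + 2 * card {(a, y). a \<in> A \<and> y \<in> residues t \<and> \<gamma> y a = a} \<in> comm_spectrum (card A + t)"
proof -
  have finA: "finite A" using A finite_residues finite_subset by blast
  obtain m where q: "quasigroup A m" and cm: "comm_pairs A m = c"
    using quasigroup_on_set[OF c finA A(2)] by blast
  let ?U = "\<lambda>a y. (y + \<gamma> y a) mod int t" and ?V = "\<lambda>x a. (x + a) mod int t"
  have res: "a mod int t = a" if "a \<in> A \<or> a \<in> G" for a using that A G by auto
  have "quasigroup (A <+> residues t) (bordered m ?U ?V P)"
  proof (rule quasigroup_bordered[OF q finA finite_residues])
    fix x assume x: "x \<in> residues t"
    show "inj_on (\<lambda>a. ?U a x) A"
      by (rule inj_onI) (use inj[OF x] \<gamma>[OF x] res in \<open>auto simp: add_mod_eq_iff dest: inj_onD\<close>)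
    show "inj_on (?V x) A"
      by (rule inj_onI) (use res in \<open>auto simp: add_mod_eq_iff\<close>)
  next
    fix a assume a: "a \<in> A"
    show "inj_on (\<lambda>x. ?V x a) (residues t)"
      by (rule inj_onI) (auto simp: add_mod_eq_iff)
  qed (use h \<gamma> col t in \<open>auto simp: hollow_def\<close>)
  moreover have "{(a, x). a \<in> A \<and> x \<in> residues t \<and> ?U a x = ?V x a}
      = {(a, y). a \<in> A \<and> y \<in> residues t \<and> \<gamma> y a = a}"
    using res \<gamma> by (auto simp: add_mod_eq_iff)
  ultimately show ?thesis
    using comm_pairs_in_comm_spectrum[of "A <+> residues t" "bordered m ?U ?V P"]
      comm_pairs_bordered[OF finA finite_residues[of t], of m ?U ?V P] finA
    by (simp add: cm card_Plus)
qed

section \<open>Controlling the agreement of the two borders\<close>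

lemma hollow_permuted_spectrum:
  assumes h: "hollow t A G P" and t: "t > 0" and A: "A \<subseteq> residues t" "A \<noteq> {}" and G: "G \<subseteq> residues t"
    and c: "c \<in> comm_spectrum (card A)"
    and \<pi>: "\<pi> ` A \<subseteq> G" "inj_on \<pi> A"
  shows "c + sym_cells (residues t) P + 2 * t * card {a \<in> A. \<pi> a = a} \<in> comm_spectrum (card A + t)"
proof -
  have "{(a, y). a \<in> A \<and> y \<in> residues t \<and> \<pi> a = a} = {a \<in> A. \<pi> a = a} \<times> residues t" by auto
  moreover have "inj_on (\<lambda>y. (y + \<pi> a) mod int t) (residues t)" for a
    by (rule inj_onI) (auto simp: add_mod_eq_iff)
  ultimately show ?thesis
    using hollow_spectrum[OF h t A G c, of "\<lambda>_. \<pi>"] \<pi>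
    by (auto simp: card_cartesian_product mult_ac)
qed

text \<open>The elements above \<open>p\<close> are fixed and those below move up by one. With the least element for
  \<open>w\<close> this is a cycle on an initial segment; with \<open>w\<close> just above the greatest element it is an
  injection from an interval onto its translate by one.\<close>

definition advance :: "int \<Rightarrow> int \<Rightarrow> int \<Rightarrow> int" where
  "advance p w a = (if a < p then a + 1 else if a = p then w else a)"

text \<open>Here the two borders have to use offset sets that differ by a translation. The set common to
  both has \<open>s - 1\<close> elements, and every number of fixed points up to \<open>s - 1\<close> occurs.\<close>

lemma hollow_shifted_spectrum:
  assumes h: "hollow t {l..<l + int s} {l + 1..l + int s} P" and t: "l \<ge> 0" "l + int s < int t"
    and c: "c \<in> comm_spectrum s" and j: "j < s"
  shows "c + sym_cells (residues t) P + 2 * t * j \<in> comm_spectrum (s + t)"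
proof -
  let ?\<pi> = "advance (l + int s - 1 - int j) (l + int s)"
  have "{a \<in> {l..<l + int s}. ?\<pi> a = a} = {l + int s - int j..<l + int s}"
    using j by (auto simp: advance_def split: if_splits)
  then have "card {a \<in> {l..<l + int s}. ?\<pi> a = a} = j" by simp
  moreover have "?\<pi> ` {l..<l + int s} \<subseteq> {l + 1..l + int s}" "inj_on ?\<pi> {l..<l + int s}"
    using j by (auto simp: advance_def inj_on_def split: if_splits)
  moreover have "{l + 1..l + int s} \<subseteq> residues t" "{l..<l + int s} \<subseteq> residues t"
    using t by (auto simp: residues_def)
  ultimately show ?thesis
    using hollow_permuted_spectrum[OF h, of c ?\<pi>] t c j by auto
qed

text \<open>A permutation of \<open>s\<close> points can have any number of fixed points except \<open>s - 1\<close>.\<close>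

lemma hollow_cycled_spectrum:
  assumes h: "hollow t {l..<l + int s} {l..<l + int s} P" and t: "l \<ge> 0" "l + int s \<le> int t"
    and c: "c \<in> comm_spectrum s" and s: "s > 0" and j: "j + 2 \<le> s \<or> j = s"
  shows "c + sym_cells (residues t) P + 2 * t * j \<in> comm_spectrum (s + t)"
proof -
  let ?\<pi> = "advance (if j = s then l else l + int s - 1 - int j) l"
  have "{a \<in> {l..<l + int s}. ?\<pi> a = a} = {l + int s - int j..<l + int s}"
    using j by (auto simp: advance_def split: if_splits)
  then have "card {a \<in> {l..<l + int s}. ?\<pi> a = a} = j" by simp
  moreover have "?\<pi> ` {l..<l + int s} \<subseteq> {l..<l + int s}" "inj_on ?\<pi> {l..<l + int s}"
    using j by (auto simp: advance_def inj_on_def split: if_splits)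
  ultimately show ?thesis
    using hollow_permuted_spectrum[OF h, of c ?\<pi>] t c s by (auto simp: residues_def)
qed

lemma card_small_residues:
  assumes "i \<le> h"
  shows "card {y \<in> residues (2 * h). y mod int h < int i} = 2 * i"
proof -
  have "{y \<in> residues (2 * h). y mod int h < int i} = {0..<int i} \<union> {int h..<int h + int i}"
    (is "?L = ?R")
  proof -
    have "y \<in> ?L \<longleftrightarrow> y \<in> ?R" for y
    proof (cases "int h \<le> y \<and> y < 2 * int h")
      case True
      then have "y mod int h = y - int h"
        using minus_mod_self2[of y "int h"] mod_pos_pos_trivial[of "y - int h" "int h"] by simp
      with True show ?thesis using assms by (auto simp: residues_def)
    next
      case False
      then show ?thesis using assms by (auto simp: residues_def)
    qed
    then show ?thesis by blast
  qed
  moreover have "card ?R = card {0..<int i} + card {int h..<int h + int i}"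
    by (rule card_Un_disjoint) (use assms in auto)
  ultimately show ?thesis by simp
qed

text \<open>A finer adjustment, starting from borders in full agreement. For even \<open>t = 2 * h\<close> the border
  rows \<open>b\<close> and \<open>b + h\<close> meet the columns \<open>y\<close> and \<open>y + h\<close> in a \<open>2 \<times> 2\<close> subsquare, because both
  \<open>y + (b + h)\<close> and \<open>(y + h) + b\<close> are the same symbol. Exchanging the two rows inside one such
  subsquare destroys four agreements, that is, eight ordered commuting pairs. This fills the gap
  left by the missing number \<open>s - 1\<close> of fixed points.\<close>

lemma hollow_switched_spectrum:
  assumes h: "hollow (2 * h) A A P" and A: "A \<subseteq> residues (2 * h)"
    and b: "b \<in> A" "b + int h \<in> A" and h0: "h > 0"
    and c: "c \<in> comm_spectrum (card A)" and i: "i \<le> h"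
    and k: "k + 8 * i = c + sym_cells (residues (2 * h)) P + 2 * (2 * h) * card A"
  shows "k \<in> comm_spectrum (card A + 2 * h)"
proof -
  let ?R = "residues (2 * h)"
  define \<gamma> where "\<gamma> y = (if y mod int h < int i then transpose b (b + int h) else id)" for y
  have finA: "finite A" using A finite_residues finite_subset by blast
  have \<gamma>A: "\<gamma> y a \<in> A" if "a \<in> A" for y a
    using that b by (auto simp: \<gamma>_def transpose_def)
  have inj: "inj_on (\<gamma> y) A" for y by (simp add: \<gamma>_def)
  \<comment> \<open>Modulo \<open>h\<close> the exchange is invisible, so the columns stay injective.\<close>
  have \<gamma>mod: "\<gamma> y a mod int h = a mod int h" for y a
    by (auto simp: \<gamma>_def transpose_def)
  have col: "inj_on (\<lambda>y. (y + \<gamma> y a) mod int (2 * h)) ?R" for a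
  proof (rule inj_onI)
    fix y z assume yz: "y \<in> ?R" "z \<in> ?R"
      and eq: "(y + \<gamma> y a) mod int (2 * h) = (z + \<gamma> z a) mod int (2 * h)"
    have "(y + \<gamma> y a) mod int h = (z + \<gamma> z a) mod int h"
      using eq by (simp add: mod_eq_dvd_iff) (metis dvd_mult_right)
    then have "(y + a) mod int h = (z + a) mod int h"
      by (metis \<gamma>mod mod_add_right_eq)
    then have "\<gamma> y = \<gamma> z" by (simp add: \<gamma>_def add_mod_eq_iff)
    with eq yz show "y = z" by (simp only: add_mod_eq_iff residues_mod)
  qed
  let ?E = "{(a, y). a \<in> A \<and> y \<in> ?R \<and> \<gamma> y a = a}"
  let ?S = "{y \<in> ?R. y mod int h < int i}"
  have "A \<times> ?R = ?E \<union> {b, b + int h} \<times> ?S"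
    using b h0 by (auto simp: \<gamma>_def transpose_def)
  moreover have "?E \<inter> {b, b + int h} \<times> ?S = {}"
    using h0 by (auto simp: \<gamma>_def)
  moreover have "finite ?E" by (rule finite_subset[of _ "A \<times> ?R"]) (use finA in auto)
  ultimately have "card (A \<times> ?R) = card ?E + card ({b, b + int h} \<times> ?S)"
    by (metis (no_types, lifting) card_Un_disjoint finA finite_SigmaI finite_Un finite_residues)
  then have "2 * h * card A = card ?E + 4 * i"
    using h0 card_small_residues[OF i] by (simp add: card_cartesian_product mult_ac)
  moreover have "c + sym_cells ?R P + 2 * card ?E \<in> comm_spectrum (card A + 2 * h)"
    by (rule hollow_spectrum[OF h _ A _ A c, of \<gamma>]) (use h0 b \<gamma>A inj col in auto)
  moreover have "2 * (2 * h) * card A = 2 * (2 * h * card A)" by simp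
  ultimately have "k = c + sym_cells ?R P + 2 * card ?E" using k by linarith
  then show ?thesis
    using \<open>c + sym_cells ?R P + 2 * card ?E \<in> comm_spectrum (card A + 2 * h)\<close> by simp
qed

section \<open>Doubling\<close>

text \<open>The borders are full Latin squares and the remaining quarter is a copy of a quasigroup on the
  symbols of the subsquare.\<close>

lemma doubling_spectrum:
  assumes c: "c \<in> comm_spectrum s" and c': "c' \<in> comm_spectrum s"
    and s: "s > 0" and j: "j + 2 \<le> s \<or> j = s"
  shows "c + c' + 2 * s * j \<in> comm_spectrum (2 * s)"
proof -
  have "residues s \<noteq> {}" using s by (auto simp: residues_def)
  then obtain m where q: "quasigroup (residues s) m" and cm: "comm_pairs (residues s) m = c'"
    using quasigroup_on_set[of c' "residues s"] c' by auto
  interpret quasigroup "residues s" m by fact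
  let ?P = "\<lambda>x y. Inl (m x y) :: int + int"
  have "hollow s (residues s) (residues s) ?P"
    using quasigroup_cancel[OF q] closed by (auto simp: hollow_def inj_on_def)
  then have "c + sym_cells (residues s) ?P + 2 * s * j \<in> comm_spectrum (s + s)"
    by (intro hollow_cycled_spectrum[where l = 0]) (use c s j in \<open>auto simp: residues_def\<close>)
  moreover have "sym_cells (residues s) ?P = c'"
    by (simp add: sym_cells_def comm_pairs_def flip: cm)
  ultimately show ?thesis by (simp add: mult_2)
qed

section \<open>Cyclic fillings in which only the diagonal commutes\<close>

text \<open>The entry in a cell depends on \<open>d = y - x\<close> only, up to adding \<open>x\<close> to the symbols of the second
  kind. Such a symbol \<open>x + e\<close> is \<open>y + (e - d)\<close> when it is read from its column.\<close>

definition circulant :: "nat \<Rightarrow> (int \<Rightarrow> int + int) \<Rightarrow> int \<Rightarrow> int \<Rightarrow> int + int" where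
  "circulant t \<phi> x y =
    (case \<phi> ((y - x) mod int t) of Inl a \<Rightarrow> Inl a | Inr e \<Rightarrow> Inr ((x + e) mod int t))"

lemma hollow_circulant:
  assumes t: "t > 0"
    and \<phi>: "\<And>d. d \<in> residues t \<Longrightarrow> \<phi> d \<in> A <+> residues t" "inj_on \<phi> (residues t)"
    and A: "A \<subseteq> residues t" "G \<subseteq> residues t"
    and row: "\<And>d e. d \<in> residues t \<Longrightarrow> \<phi> d = Inr e \<Longrightarrow> e \<notin> A"
    and col: "\<And>d e. d \<in> residues t \<Longrightarrow> \<phi> d = Inr e \<Longrightarrow> (e - d) mod int t \<notin> G"
    and col_inj: "\<And>d e d' e'. d \<in> residues t \<Longrightarrow> d' \<in> residues t \<Longrightarrow> \<phi> d = Inr e \<Longrightarrow> \<phi> d' = Inr e' \<Longrightarrow>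
      (e - d) mod int t = (e' - d') mod int t \<Longrightarrow> d = d'"
  shows "hollow t A G (circulant t \<phi>)"
proof -
  have R: "(y - x) mod int t \<in> residues t" for x y using t by simp
  have e: "e mod int t = e" if "d \<in> residues t" "\<phi> d = Inr e" for d e
    using \<phi>(1)[OF that(1)] that(2) by auto
  have x_e: "(x + e) mod int t = (y + (e - (y - x) mod int t) mod int t) mod int t" for x y e
  proof -
    have "(y + (e - (y - x) mod int t) mod int t) mod int t = (y + (e - (y - x))) mod int t"
      by (simp only: mod_add_right_eq mod_diff_right_eq)
    then show ?thesis by (simp add: add.commute)
  qed
  have inj_row: "y = z" if xyz: "x \<in> residues t" "y \<in> residues t" "z \<in> residues t"
    and eq: "circulant t \<phi> x y = circulant t \<phi> x z" for x y z
  proof -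
    define d d' where "d = (y - x) mod int t" and "d' = (z - x) mod int t"
    have dR: "d \<in> residues t" "d' \<in> residues t" using R by (simp_all add: d_def d'_def)
    have "\<phi> d = \<phi> d'"
      using eq e[OF dR(1)] e[OF dR(2)]
      by (cases "\<phi> d"; cases "\<phi> d'") (simp_all add: circulant_def add_mod_eq_iff flip: d_def d'_def)
    then have "d = d'" using \<phi>(2) dR by (meson inj_onD)
    then have "int t dvd y - z" by (simp add: d_def d'_def mod_eq_dvd_iff)
    then show "y = z" using xyz by (metis mod_eq_dvd_iff residues_mod)
  qed
  have inj_col: "y = z" if xyz: "x \<in> residues t" "y \<in> residues t" "z \<in> residues t"
    and eq: "circulant t \<phi> y x = circulant t \<phi> z x" for x y z
  proof -
    define d d' where "d = (x - y) mod int t" and "d' = (x - z) mod int t"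
    have dR: "d \<in> residues t" "d' \<in> residues t" using R by (simp_all add: d_def d'_def)
    have "d = d'"
    proof (cases "\<phi> d")
      case (Inl a)
      with eq have "\<phi> d = \<phi> d'"
        by (cases "\<phi> d'") (simp_all add: circulant_def flip: d_def d'_def)
      then show ?thesis using \<phi>(2) dR by (meson inj_onD)
    next
      case (Inr f)
      with eq obtain f' where f': "\<phi> d' = Inr f'"
        and "(y + f) mod int t = (z + f') mod int t"
        by (cases "\<phi> d'") (simp_all add: circulant_def flip: d_def d'_def)
      then have "(f - d) mod int t = (f' - d') mod int t"
        using x_e[of y f x] x_e[of z f' x] by (simp add: add_mod_eq_iff flip: d_def d'_def)
      then show ?thesis using col_inj[OF dR Inr f'] by simp
    qed
    then have "int t dvd z - y" by (simp add: d_def d'_def mod_eq_dvd_iff)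
    then show "y = z" using xyz by (metis mod_eq_dvd_iff residues_mod)
  qed
  have "circulant t \<phi> x y \<noteq> Inr ((x + a) mod int t)" if a: "a \<in> A" for x y a
  proof (cases "\<phi> ((y - x) mod int t)")
    case (Inr f)
    have "f mod int t \<noteq> a mod int t"
      using row[OF R Inr] e[OF R Inr] a A(1) by (metis residues_mod subsetD)
    then show ?thesis by (simp add: circulant_def Inr add_mod_eq_iff)
  qed (simp add: circulant_def)
  moreover have "circulant t \<phi> x y \<noteq> Inr ((y + g) mod int t)" if g: "g \<in> G" for x y g
  proof (cases "\<phi> ((y - x) mod int t)")
    case (Inr f)
    have "(f - (y - x) mod int t) mod int t \<noteq> g mod int t"
      using col[OF R Inr] g A(2) by (metis residues_mod subsetD)
    then show ?thesis using x_e[of x f y] by (simp add: circulant_def Inr add_mod_eq_iff)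
  qed (simp add: circulant_def)
  moreover have "circulant t \<phi> x y \<in> A <+> residues t" for x y
    using \<phi>(1)[OF R, of y x] t by (cases "\<phi> ((y - x) mod int t)") (auto simp: circulant_def)
  ultimately show ?thesis
    using inj_row inj_col unfolding hollow_def inj_on_def by blast
qed

text \<open>A symbol of \<open>A\<close> occurs for one difference \<open>d\<close> only, and \<open>d\<close> is never its own negative because
  \<open>t\<close> is odd.\<close>

lemma sym_cells_circulant:
  assumes t: "odd t"
    and inj: "inj_on \<phi> (residues t)"
    and asym: "\<And>d e e'. d \<in> residues t \<Longrightarrow> d \<noteq> 0 \<Longrightarrow> \<phi> d = Inr e \<Longrightarrow> \<phi> (int t - d) \<noteq> Inr e'"
  shows "sym_cells (residues t) (circulant t \<phi>) = t"
proof -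
  have t0: "t > 0" using t by (auto intro: Nat.gr0I)
  have ne: "circulant t \<phi> x y \<noteq> circulant t \<phi> y x"
    if xy: "x \<in> residues t" "y \<in> residues t" "x \<noteq> y" for x y
  proof
    assume eq: "circulant t \<phi> x y = circulant t \<phi> y x"
    let ?d = "(y - x) mod int t" and ?d' = "(x - y) mod int t"
    have R: "?d \<in> residues t" "?d' \<in> residues t" using t0 by auto
    have nz: "?d \<noteq> 0" using xy by (metis mod_eq_dvd_iff mod_0_imp_dvd residues_mod)
    have d': "?d' = int t - ?d" using nz by (metis minus_diff_eq zmod_zminus1_eq_if)
    show False
    proof (cases "\<phi> ?d")
      case (Inl a)
      with eq have "\<phi> ?d = \<phi> ?d'" by (auto simp: circulant_def split: sum.splits)
      then have "?d = ?d'" using inj R by (meson inj_onD)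
      then have "int t = 2 * ?d" using d' by simp
      then have "even (int t)" by (metis dvd_triv_left)
      with t show False by simp
    next
      case (Inr e)
      with eq obtain e' where "\<phi> ?d' = Inr e'" by (auto simp: circulant_def split: sum.splits)
      with asym[OF R(1) nz Inr] d' show False by simp
    qed
  qed
  have "{(x, y). x \<in> residues t \<and> y \<in> residues t \<and> circulant t \<phi> x y = circulant t \<phi> y x}
      = (\<lambda>x. (x, x)) ` residues t"
    using ne by auto
  then show ?thesis by (simp add: sym_cells_def card_image inj_on_def)
qed

text \<open>One difference, \<open>-1\<close>, carries symbols of the second kind. Row \<open>x\<close> then uses the offset \<open>-1\<close>
  and column \<open>y\<close> the offset \<open>0\<close>, which leaves the intervals \<open>{0..t - 2}\<close> and \<open>{1..t - 1}\<close> to the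
  borders.\<close>

lemma low_values_1:
  assumes t: "odd t" "t \<ge> 3" and s: "t = s + 1" and c: "c \<in> comm_spectrum s" and j: "j < s"
  shows "c + t + 2 * t * j \<in> comm_spectrum (s + t)"
proof -
  define \<phi> :: "int \<Rightarrow> int + int" where
    "\<phi> d = (if d = int t - 1 then Inr (int t - 1) else Inl d)" for d
  have "hollow t {0..<0 + int s} {0 + 1..0 + int s} (circulant t \<phi>)"
    by (rule hollow_circulant)
       (use t s in \<open>auto simp: \<phi>_def residues_def inj_on_def split: if_splits\<close>)
  moreover have "sym_cells (residues t) (circulant t \<phi>) = t"
    by (rule sym_cells_circulant)
       (use t in \<open>auto simp: \<phi>_def residues_def inj_on_def split: if_splits\<close>)
  ultimately show ?thesis
    using hollow_shifted_spectrum[of t 0 s "circulant t \<phi>" c j] s c j by simp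
qed

text \<open>Three differences, \<open>0\<close>, \<open>-1\<close> and \<open>-2\<close>, carry the offsets \<open>0\<close>, \<open>1\<close> and \<open>-1\<close> of the second kind.
  Read from the columns these are \<open>0\<close>, \<open>2\<close> and \<open>1\<close>, so the rows leave \<open>{2..t - 2}\<close> and the
  columns \<open>{3..t - 1}\<close>. Among the three differences only \<open>0\<close> has its negative in the list, hence
  nothing off the diagonal commutes.\<close>

lemma low_values_3:
  assumes t: "odd t" "t \<ge> 5" and s: "t = s + 3" and c: "c \<in> comm_spectrum s" and j: "j < s"
  shows "c + t + 2 * t * j \<in> comm_spectrum (s + t)"
proof -
  define \<phi> :: "int \<Rightarrow> int + int" where
    "\<phi> d = (if d = 0 then Inr 0 else if d = int t - 1 then Inr 1
      else if d = int t - 2 then Inr (int t - 1) else Inl (d + 1))" for d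
  have \<phi>_Inr: "(d = 0 \<and> e = 0) \<or> (d = int t - 1 \<and> e = 1) \<or> (d = int t - 2 \<and> e = int t - 1)"
    if "\<phi> d = Inr e" for d e
    using that by (auto simp: \<phi>_def split: if_splits)
  have col: "(e - d) mod int t \<in> {0, 1, 2}" "(e - d) mod int t = (e' - d') mod int t \<Longrightarrow> d = d'"
    if "\<phi> d = Inr e" "\<phi> d' = Inr e'" for d e d' e'
  proof -
    have "(1 - (int t - 1)) mod int t = 2" "(int t - 1 - (int t - 2)) mod int t = 1"
      using t minus_mod_self2[of 2 "int t"] by simp_all
    with \<phi>_Inr[OF that(1)] \<phi>_Inr[OF that(2)]
    show "(e - d) mod int t \<in> {0, 1, 2}" "(e - d) mod int t = (e' - d') mod int t \<Longrightarrow> d = d'"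
      by (elim disjE conjE; simp)+
  qed
  have "hollow t {2..<2 + int s} {2 + 1..2 + int s} (circulant t \<phi>)"
  proof (rule hollow_circulant)
    fix d e assume "\<phi> d = Inr e"
    from \<phi>_Inr[OF this] show "e \<notin> {2..<2 + int s}" using s by auto
    from col(1)[OF \<open>\<phi> d = Inr e\<close> \<open>\<phi> d = Inr e\<close>] show "(e - d) mod int t \<notin> {2 + 1..2 + int s}" by auto
  next
    fix d e d' e' assume "\<phi> d = Inr e" "\<phi> d' = Inr e'" "(e - d) mod int t = (e' - d') mod int t"
    then show "d = d'" by (rule col(2))
  qed (use t s in \<open>auto simp: \<phi>_def residues_def inj_on_def split: if_splits\<close>)
  moreover have "sym_cells (residues t) (circulant t \<phi>) = t"
    by (rule sym_cells_circulant)
       (use t in \<open>auto simp: \<phi>_def residues_def inj_on_def split: if_splits\<close>)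
  ultimately show ?thesis
    using hollow_shifted_spectrum[of t 2 s "circulant t \<phi>" c j] s c j by simp
qed

section \<open>Symmetric fillings from a one-factorization of the complete graph\<close>

lemma hollow_symmetricI:
  assumes sym: "\<And>x y. x \<in> residues t \<Longrightarrow> P x y = P y x"
    and "\<And>x y. x \<in> residues t \<Longrightarrow> y \<in> residues t \<Longrightarrow> P x y \<in> A <+> residues t"
    and "\<And>x. x \<in> residues t \<Longrightarrow> inj_on (P x) (residues t)"
    and "\<And>x y a. x \<in> residues t \<Longrightarrow> y \<in> residues t \<Longrightarrow> a \<in> A \<Longrightarrow> P x y \<noteq> Inr ((x + a) mod int t)"
  shows "hollow t A A P" "sym_cells (residues t) P = t\<^sup>2"
proof -
  have "inj_on (\<lambda>x. P x y) (residues t)" if y: "y \<in> residues t" for y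
  proof (rule inj_onI)
    fix x z assume "x \<in> residues t" "z \<in> residues t" "P x y = P z y"
    then show "x = z" using inj_onD[OF assms(3)[OF y], of x z] sym[of x y] sym[of z y] by simp
  qed
  moreover have "P x y \<noteq> Inr ((y + a) mod int t)"
    if "x \<in> residues t" "y \<in> residues t" "a \<in> A" for x y a
    using assms(4)[of y x a] sym[of x y] that by simp
  ultimately show "hollow t A A P"
    using assms(2-4) unfolding hollow_def by blast
  have "{(x, y). x \<in> residues t \<and> y \<in> residues t \<and> P x y = P y x} = residues t \<times> residues t"
    using sym by auto
  then show "sym_cells (residues t) P = t\<^sup>2"
    by (simp add: sym_cells_def card_cartesian_product power2_eq_square)
qed

text \<open>The standard one-factorization of the complete graph on the integers modulo an odd \<open>q\<close> and a
  point at infinity gives the edge \<open>{u, v}\<close> the colour \<open>u + v\<close> and the edge from \<open>u\<close> to infinity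
  the colour \<open>2 * u\<close>. The vertices are renamed along the sequence \<open>0, 1, -1, 2, -2, \<dots>\<close>, with
  infinity called \<open>q\<close>. The colours \<open>0\<close> and \<open>1\<close> then lie on the cycle \<open>0, 1, \<dots>, q\<close>.\<close>

definition zigzag :: "int \<Rightarrow> int" where
  "zigzag i = (if even i then - (i div 2) else (i + 1) div 2)"

definition color :: "nat \<Rightarrow> int \<Rightarrow> int \<Rightarrow> int" where
  "color q i j = (if j = int q then 2 * zigzag i else if i = int q then 2 * zigzag j
     else zigzag i + zigzag j) mod int q"

lemma color_commute: "color q i j = color q j i"
  by (simp add: color_def add.commute)

lemma double_zigzag: "2 * zigzag i = (if even i then - i else i + 1)"
  unfolding zigzag_def by presburger

lemma zigzag_bounds:
  assumes "odd q" "i \<in> residues q"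
  shows "1 - int q \<le> 2 * zigzag i" "2 * zigzag i \<le> int q - 1"
proof -
  have "odd (int q)" "0 \<le> i" "i < int q" using assms by (auto simp: residues_def)
  then show "1 - int q \<le> 2 * zigzag i" "2 * zigzag i \<le> int q - 1"
    unfolding double_zigzag by presburger+
qed

lemma zigzag_eqD:
  assumes "zigzag i = zigzag j" "i \<ge> 0" "j \<ge> 0"
  shows "i = j"
proof -
  have "(if even i then - i else i + 1) = (if even j then - j else j + 1)"
    unfolding double_zigzag[symmetric] assms(1) ..
  with assms(2,3) show ?thesis by (cases "even i"; cases "even j") simp_all
qed

lemma zigzag_mod_eqD:
  assumes q: "odd q" and ij: "i \<in> residues q" "j \<in> residues q"
    and eq: "zigzag i mod int q = zigzag j mod int q"
  shows "i = j"
proof -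
  have "int q dvd zigzag i - zigzag j" using eq by (simp add: mod_eq_dvd_iff)
  moreover have "\<bar>zigzag i - zigzag j\<bar> < int q"
    using zigzag_bounds[OF q ij(1)] zigzag_bounds[OF q ij(2)] odd_pos[OF q] by linarith
  ultimately have "zigzag i = zigzag j"
    using dvd_imp_le_int[of "zigzag i - zigzag j" "int q"] by linarith
  with ij show ?thesis by (auto simp: residues_def dest: zigzag_eqD)
qed

lemma color_inj:
  assumes q: "odd q" and i: "i \<in> residues (q + 1)" "j \<in> residues (q + 1)" "k \<in> residues (q + 1)"
    and ne: "j \<noteq> i" "k \<noteq> i" and eq: "color q i j = color q i k"
  shows "j = k"
proof -
  have R: "x \<in> residues q" if "x \<in> residues (q + 1)" "x \<noteq> int q" for x
    using that by (auto simp: residues_def)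
  note inj = zigzag_mod_eqD[OF q R R]
  consider "i = int q" | "i \<noteq> int q" "j = int q" "k = int q" | "i \<noteq> int q" "j = int q" "k \<noteq> int q"
    | "i \<noteq> int q" "j \<noteq> int q" "k = int q" | "i \<noteq> int q" "j \<noteq> int q" "k \<noteq> int q" by blast
  then show ?thesis
  proof cases
    case 1
    then have "int q dvd 2 * (zigzag j - zigzag k)"
      using eq ne by (simp add: color_def mod_eq_dvd_iff algebra_simps)
    then have "int q dvd zigzag j - zigzag k"
      using q by (metis coprime_dvd_mult_right_iff coprime_right_2_iff_odd even_of_nat)
    then show ?thesis using inj[OF i(2) _ i(3)] 1 ne by (simp add: mod_eq_dvd_iff)
  next
    case 3
    then have "(zigzag i + zigzag i) mod int q = (zigzag i + zigzag k) mod int q"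
      using eq by (simp add: color_def)
    then have "zigzag i mod int q = zigzag k mod int q" by (simp only: add_mod_eq_iff)
    then show ?thesis using inj[OF i(1) _ i(3)] 3 ne by simp
  next
    case 4
    then have "(zigzag i + zigzag i) mod int q = (zigzag i + zigzag j) mod int q"
      using eq by (simp add: color_def)
    then have "zigzag i mod int q = zigzag j mod int q" by (simp only: add_mod_eq_iff)
    then show ?thesis using inj[OF i(1) _ i(2)] 4 ne by simp
  next
    case 5
    then have "zigzag j mod int q = zigzag k mod int q"
      using eq by (simp add: color_def add_mod_eq_iff)
    then show ?thesis using inj[OF i(2) _ i(3)] 5 by simp
  qed simp
qed

lemma mod_in_0_1_cases:
  assumes "x mod m \<in> {0, 1}" "- m < x" "x < (m::int)"
  shows "x = 0 \<or> x = 1 \<or> x = 1 - m"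
proof (cases "x \<ge> 0")
  case True
  with assms show ?thesis by auto
next
  case False
  then have "x mod m = x + m"
    using assms mod_add_self2[of x m] mod_pos_pos_trivial[of "x + m" m] by simp
  with assms show ?thesis by auto
qed

text \<open>The representatives \<open>zigzag i\<close> have absolute value at most \<open>(q - 1) / 2\<close>. A sum of two of them
  that is \<open>0\<close> or \<open>1\<close> modulo \<open>q\<close> is therefore \<open>0\<close>, \<open>1\<close> or \<open>1 - q\<close>, and the last value needs both
  of them to be extreme and equal.\<close>

lemma color_0_1_adjacent:
  assumes q: "odd q" and ij: "i \<in> residues (q + 1)" "j \<in> residues (q + 1)" "i \<noteq> j"
    and col: "color q i j \<in> {0, 1}"
  shows "j = (i + 1) mod (int q + 1) \<or> i = (j + 1) mod (int q + 1)"
proof -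
  have oq: "odd (int q)" using q by simp
  have last: "x = 0 \<or> x = int q - 1"
    if x: "x \<in> residues q" and c: "(2 * zigzag x) mod int q \<in> {0, 1}" for x
  proof -
    from mod_in_0_1_cases[OF c] zigzag_bounds[OF q x] have "2 * zigzag x \<in> {0, 1, 1 - int q}"
      by auto
    with x show ?thesis
      unfolding double_zigzag by (cases "even x") (auto simp: residues_def)
  qed
  consider "j = int q" "i \<noteq> int q" | "i = int q" "j \<noteq> int q" | "i \<noteq> int q" "j \<noteq> int q"
    using ij by blast
  then show ?thesis
  proof cases
    case 1
    then have "i = 0 \<or> i = int q - 1"
      using last[of i] ij col by (auto simp: color_def residues_def)
    with 1 show ?thesis by auto
  next
    case 2
    then have "j = 0 \<or> j = int q - 1"
      using last[of j] ij col by (auto simp: color_def residues_def)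
    with 2 show ?thesis by auto
  next
    case 3
    then have R: "i \<in> residues q" "j \<in> residues q" using ij by (auto simp: residues_def)
    have c: "(zigzag i + zigzag j) mod int q \<in> {0, 1}" using 3 col by (simp add: color_def)
    have "zigzag i + zigzag j \<noteq> 1 - int q"
    proof
      assume "zigzag i + zigzag j = 1 - int q"
      then have "zigzag i = zigzag j"
        using zigzag_bounds[OF q R(1)] zigzag_bounds[OF q R(2)] by linarith
      with ij R show False by (auto simp: residues_def dest: zigzag_eqD)
    qed
    with mod_in_0_1_cases[OF c] zigzag_bounds[OF q R(1)] zigzag_bounds[OF q R(2)]
    have "zigzag i + zigzag j = 0 \<or> zigzag i + zigzag j = 1" by auto
    moreover have "0 \<le> i" "0 \<le> j" "i < int q" "j < int q" using R by (auto simp: residues_def)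
    moreover from calculation(1) have
      "(if even i then - i else i + 1) + (if even j then - j else j + 1) \<in> {0, 2}"
      unfolding double_zigzag[symmetric] by auto
    ultimately have "j = i + 1 \<or> i = j + 1"
      using ij(3) by (cases "even i"; cases "even j") auto
    with \<open>0 \<le> i\<close> \<open>0 \<le> j\<close> \<open>i < int q\<close> \<open>j < int q\<close> show ?thesis by auto
  qed
qed

text \<open>Every colour becomes a symbol of the subsquare; only the diagonal is left for the residues.\<close>

definition matching_filling :: "nat \<Rightarrow> int \<Rightarrow> int \<Rightarrow> int + int" where
  "matching_filling t x y = (if x = y then Inr x else Inl (color (t - 1) x y + 1))"

lemma matching_filling:
  assumes t: "even t" "t > 0"
  shows "hollow t {1..int t - 1} {1..int t - 1} (matching_filling t)"
    and "sym_cells (residues t) (matching_filling t) = t\<^sup>2"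
proof -
  have q: "odd (t - 1)" "t = (t - 1) + 1" using t by (auto elim: oddE)
  have sym: "matching_filling t x y = matching_filling t y x" for x y
    by (simp add: matching_filling_def color_commute)
  have row: "inj_on (matching_filling t x) (residues t)" if "x \<in> residues t" for x
    using color_inj[OF q(1), folded q(2), OF that]
    by (auto simp: inj_on_def matching_filling_def split: if_splits)
  have mem: "matching_filling t x y \<in> {1..int t - 1} <+> residues t"
    if "x \<in> residues t" for x y
  proof -
    have "0 \<le> color (t - 1) x y" "color (t - 1) x y < int (t - 1)"
      using q(1) by (auto simp: color_def odd_pos)
    with that show ?thesis by (auto simp: matching_filling_def)
  qed
  have out: "matching_filling t x y \<noteq> Inr ((x + a) mod int t)"
    if "x \<in> residues t" "a \<in> {1..int t - 1}" for x y a
    using that add_mod_eq_iff(1)[of x 0 "int t" a] by (auto simp: matching_filling_def residues_def)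
  show "hollow t {1..int t - 1} {1..int t - 1} (matching_filling t)"
    and "sym_cells (residues t) (matching_filling t) = t\<^sup>2"
    using hollow_symmetricI[of t "matching_filling t" "{1..int t - 1}"] sym row mem out by blast+
qed

text \<open>The colours \<open>0\<close> and \<open>1\<close> are given up, and their cells, which lie next to the diagonal, take
  residues: row \<open>x\<close> has \<open>x + 1\<close> on the diagonal, \<open>x\<close> to the right of it and \<open>x - 1\<close> to the left.\<close>

definition cycle_filling :: "nat \<Rightarrow> int \<Rightarrow> int \<Rightarrow> int + int" where
  "cycle_filling t x y =
    (if x = y then Inr ((x + 1) mod int t)
     else if y = (x + 1) mod int t then Inr x
     else if x = (y + 1) mod int t then Inr y
     else Inl (color (t - 1) x y))"

lemma cycle_filling:
  assumes t: "even t" "t > 2"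
  shows "hollow t {2..int t - 2} {2..int t - 2} (cycle_filling t)"
    and "sym_cells (residues t) (cycle_filling t) = t\<^sup>2"
proof -
  have q: "odd (t - 1)" "t = (t - 1) + 1" "int (t - 1) + 1 = int t" using t by (auto elim: oddE)
  have shift: "(x + a) mod int t = (x + b) mod int t \<Longrightarrow> a \<in> residues t \<Longrightarrow> b \<in> residues t \<Longrightarrow> a = b" for x a b
    by (simp add: add_mod_eq_iff)
  have res: "0 \<in> residues t" "1 \<in> residues t" "2 \<in> residues t" using t by (auto simp: residues_def)
  have self: "(x + 0) mod int t = x" if "x \<in> residues t" for x using that by simp
  have two: "((x + 1) mod int t + 1) mod int t = (x + 2) mod int t" for x
    by (simp add: mod_add_left_eq add.assoc)
  have one_ne: "(x + 1) mod int t \<noteq> x" and two_ne: "((x + 1) mod int t + 1) mod int t \<noteq> x"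
    if "x \<in> residues t" for x
    using shift[of x 1 0] shift[of x 2 0] self[OF that] res two[of x] by auto
  have suc_inj: "x = y" if "(x + 1) mod int t = (y + 1) mod int t" "x \<in> residues t" "y \<in> residues t" for x y
    using that by (simp add: add_mod_eq_iff)
  have col: "color (t - 1) x y \<in> {2..int t - 2}"
    if "x \<in> residues t" "y \<in> residues t" "x \<noteq> y" "y \<noteq> (x + 1) mod int t" "x \<noteq> (y + 1) mod int t" for x y
  proof -
    have "0 \<le> color (t - 1) x y" "color (t - 1) x y < int (t - 1)"
      using q(1) by (auto simp: color_def odd_pos)
    moreover have "color (t - 1) x y \<notin> {0, 1}"
      using color_0_1_adjacent[OF q(1), folded q(2), OF that(1-3)] that(4,5) q(3) by auto
    ultimately show ?thesis using q(3) by auto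
  qed
  have Inr_cases: "y = x \<and> z = (x + 1) mod int t \<or> y = (x + 1) mod int t \<and> z = x
      \<or> x = (y + 1) mod int t \<and> z = y"
    if "cycle_filling t x y = Inr z" for x y z
    using that by (auto simp: cycle_filling_def split: if_splits)
  have row: "inj_on (cycle_filling t x) (residues t)" if x: "x \<in> residues t" for x
  proof (rule inj_onI)
    fix y z assume yz: "y \<in> residues t" "z \<in> residues t"
      and eq: "cycle_filling t x y = cycle_filling t x z"
    show "y = z"
    proof (cases "cycle_filling t x y")
      case (Inl a)
      with eq have "color (t - 1) x y = color (t - 1) x z" "y \<noteq> x" "z \<noteq> x"
        by (auto simp: cycle_filling_def split: if_splits)
      then show ?thesis using color_inj[OF q(1), folded q(2), OF x yz] by simp
    next
      case (Inr w)
      then have w: "cycle_filling t x y = Inr w" "cycle_filling t x z = Inr w" using eq by simp_all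
      from Inr_cases[OF w(1)] Inr_cases[OF w(2)] one_ne[OF x] two_ne[OF x]
      show ?thesis by (elim disjE conjE; metis)
    qed
  qed
  have out: "cycle_filling t x y \<noteq> Inr ((x + a) mod int t)"
    if x: "x \<in> residues t" and a: "a \<in> {2..int t - 2}" for x y a
  proof
    assume "cycle_filling t x y = Inr ((x + a) mod int t)"
    from Inr_cases[OF this] show False
    proof (elim disjE conjE)
      assume "(x + a) mod int t = (x + 1) mod int t"
      from shift[OF this] a res show False by (auto simp: residues_def)
    next
      assume "(x + a) mod int t = x"
      then have "(x + a) mod int t = (x + 0) mod int t" using self[OF x] by simp
      from shift[OF this] a res show False by (auto simp: residues_def)
    next
      assume "(x + a) mod int t = y" "x = (y + 1) mod int t"
      then have "(x + (a + 1)) mod int t = (x + 0) mod int t"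
        using self[OF x] by (metis add.assoc mod_add_left_eq)
      from shift[OF this] a res show False by (auto simp: residues_def)
    qed
  qed
  have sym: "cycle_filling t x y = cycle_filling t y x" if "x \<in> residues t" for x y
    using two_ne[OF that] by (auto simp: cycle_filling_def color_commute)
  have mem: "cycle_filling t x y \<in> {2..int t - 2} <+> residues t"
    if "x \<in> residues t" "y \<in> residues t" for x y
    using that col[OF that] t by (auto simp: cycle_filling_def)
  show "hollow t {2..int t - 2} {2..int t - 2} (cycle_filling t)"
    and "sym_cells (residues t) (cycle_filling t) = t\<^sup>2"
    using hollow_symmetricI[of t "cycle_filling t" "{2..int t - 2}"] sym row mem out by blast+
qed

section \<open>Filling intervals by induction on the order\<close>

lemma square_in_spectrum:
  assumes "n > 0"
  shows "n\<^sup>2 \<in> comm_spectrum n"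
proof -
  let ?m = "\<lambda>x y. (x + y) mod int n"
  have "quasigroup (residues n) ?m"
    by (rule finite_quasigroupI)
       (use assms in \<open>auto simp: inj_on_def add_mod_eq_iff residues_def\<close>)
  moreover have "comm_pairs (residues n) ?m = n\<^sup>2"
  proof -
    have "{(x, y). x \<in> residues n \<and> y \<in> residues n \<and> ?m x y = ?m y x} = residues n \<times> residues n"
      by (auto simp: add.commute)
    then show ?thesis by (simp add: comm_pairs_def card_cartesian_product power2_eq_square)
  qed
  ultimately show ?thesis
    using comm_pairs_in_comm_spectrum[of "residues n" ?m] by simp
qed

lemma mod_2_eq_iff: "(a::nat) mod 2 = b mod 2 \<longleftrightarrow> (even a \<longleftrightarrow> even b)"
  by (simp add: mod2_eq_if)

text \<open>Translates by multiples of \<open>w\<close> of an interval of numbers of one parity overlap or touch when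
  \<open>w\<close> exceeds the length of the interval by at most two.\<close>

lemma window_cover:
  fixes k b L H w J :: nat
  assumes "b + L \<le> k" "k \<le> b + H + w * J" "even w" "w + L \<le> H + 2"
    "k mod 2 = (b + L) mod 2" "H mod 2 = L mod 2"
  obtains j e where "j \<le> J" "L \<le> e" "e \<le> H" "e mod 2 = L mod 2" "k = b + e + w * j"
proof -
  have "\<exists>j e. j \<le> J \<and> L \<le> e \<and> e \<le> H \<and> e mod 2 = L mod 2 \<and> k = b + e + w * j"
    using assms(2)
  proof (induction J)
    case 0
    then have "L \<le> k - b" "k - b \<le> H" "k = b + (k - b) + w * 0" using assms(1) by auto
    moreover have "(k - b) mod 2 = L mod 2"
    proof -
      obtain d where "k = b + d" using assms(1) by (metis add.assoc le_iff_add)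
      with assms(5) show ?thesis by (simp add: mod2_eq_if split: if_splits)
    qed
    ultimately show ?case by blast
  next
    case (Suc J)
    show ?case
    proof (cases "k \<le> b + H + w * J")
      case True
      with Suc.IH show ?thesis by (meson le_Suc_eq)
    next
      case False
      obtain v where v: "w = 2 * v" using assms(3) by blast
      define u where "u = w * J"
      define e where "e = k - b - (u + w)"
      have wS: "w * Suc J = u + w" by (simp add: u_def)
      have evu: "even u" by (simp add: u_def v)
      have kH: "b + H + u < k" "k \<le> b + H + (u + w)" using False Suc.prems wS by (auto simp: u_def)
      have "k \<noteq> Suc (b + H + u)" using evu assms(5,6) by (auto simp: mod_2_eq_iff)
      then have "b + H + u + 2 \<le> k" using kH(1) by simp
      then have "k = b + e + (u + w)" "L \<le> e" "e \<le> H"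
        using kH assms(4) unfolding e_def by linarith+
      moreover from this(1) have "e mod 2 = L mod 2" using evu assms(3,5) by (auto simp: mod_2_eq_iff)
      ultimately show ?thesis using wS by (intro exI[of _ "Suc J"] exI[of _ e]) auto
    qed
  qed
  with that show ?thesis by blast
qed

lemma square_parity: "(s\<^sup>2 :: nat) mod 2 = s mod 2"
  by (simp add: power2_eq_square mod2_eq_if)

lemma minus_6_parity:
  assumes "6 \<le> s\<^sup>2"
  shows "(s\<^sup>2 - 6) mod 2 = (s::nat) mod 2"
proof -
  have "(s\<^sup>2 - 6) mod 2 = (s\<^sup>2 - 6 + 2 * 3) mod 2" by (rule mod_mult_self2[symmetric])
  then show ?thesis using assms square_parity[of s] by simp
qed

lemma low_range:
  assumes D: "D_set s \<subseteq> comm_spectrum s"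
    and real: "\<And>c j. c \<in> comm_spectrum s \<Longrightarrow> j < s \<Longrightarrow> c + t + 2 * t * j \<in> comm_spectrum (s + t)"
    and size: "2 * t + s + 4 \<le> s\<^sup>2" and s: "s \<ge> 4"
    and k: "s + t \<le> k" "k mod 2 = (s + t) mod 2" "k + 6 \<le> t + s\<^sup>2 + 2 * t * (s - 1)"
  shows "k \<in> comm_spectrum (s + t)"
proof -
  obtain j c where *: "j \<le> s - 1" "s \<le> c" "c \<le> s\<^sup>2 - 6" "c mod 2 = s mod 2" "k = t + c + 2 * t * j"
  proof (rule window_cover[of t s k "s\<^sup>2 - 6" "2 * t" "s - 1"])
    show "(s\<^sup>2 - 6) mod 2 = s mod 2" using size s by (intro minus_6_parity) linarith
  qed (use k size in \<open>auto simp: add.commute\<close>)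
  have "c + 6 \<le> s\<^sup>2" using * size s by linarith
  with * have "c \<in> D_set s" by (auto simp: D_set_def)
  moreover have "j < s" using * s by linarith
  ultimately show ?thesis using real[of c j] D * by (auto simp: add.commute)
qed

lemma high_values:
  assumes h: "hollow (2 * h) {l..<l + int s} {l..<l + int s} P"
    and P: "sym_cells (residues (2 * h)) P = (2 * h)\<^sup>2"
    and l: "0 \<le> l" "l + int s \<le> int (2 * h)"
    and b: "b \<in> {l..<l + int s}" "b + int h \<in> {l..<l + int s}" "h > 0"
    and c: "c \<in> comm_spectrum s" and t: "t = 2 * h"
  shows "j + 2 \<le> s \<or> j = s \<Longrightarrow> c + t\<^sup>2 + 2 * t * j \<in> comm_spectrum (s + t)"
    and "i \<le> h \<Longrightarrow> k + 8 * i = c + t\<^sup>2 + 2 * t * s \<Longrightarrow> k \<in> comm_spectrum (s + t)"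
proof -
  have s: "s > 0" using b by auto
  show "c + t\<^sup>2 + 2 * t * j \<in> comm_spectrum (s + t)" if "j + 2 \<le> s \<or> j = s"
    using hollow_cycled_spectrum[OF h l c s that] by (simp add: P t)
  show "k \<in> comm_spectrum (s + t)" if "i \<le> h" "k + 8 * i = c + t\<^sup>2 + 2 * t * s"
  proof -
    have "{l..<l + int s} \<subseteq> residues (2 * h)" using l by (auto simp: residues_def)
    then show ?thesis using hollow_switched_spectrum[OF h _ b, of c i k] that c by (simp add: P t)
  qed
qed

text \<open>Up to \<open>s - 2\<close> agreeing border rows the translates by \<open>2 * t\<close> suffice. Full agreement with all
  \<open>h\<close> switches has the same count as \<open>s - 2\<close> agreeing rows, so removing the switches one at a time
  continues from there in steps of eight.\<close>

lemma high_range: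
  assumes D: "D_set s \<subseteq> comm_spectrum s"
    and cyc: "\<And>c j. c \<in> comm_spectrum s \<Longrightarrow> j + 2 \<le> s \<or> j = s \<Longrightarrow> c + t\<^sup>2 + 2 * t * j \<in> comm_spectrum (s + t)"
    and sw: "\<And>c i k. c \<in> comm_spectrum s \<Longrightarrow> i \<le> h \<Longrightarrow> k + 8 * i = c + t\<^sup>2 + 2 * t * s \<Longrightarrow> k \<in> comm_spectrum (s + t)"
    and t: "t = 2 * h" and size: "2 * t + s + 4 \<le> s\<^sup>2" and s: "s \<ge> 4" "t \<ge> 4"
    and k: "t\<^sup>2 + s \<le> k" "k mod 2 = (s + t) mod 2" "k + 6 \<le> (s + t)\<^sup>2"
  shows "k \<in> comm_spectrum (s + t)"
proof -
  have par: "(s\<^sup>2 - 6) mod 2 = s mod 2" using size s by (intro minus_6_parity) linarith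
  have size': "2 * t + s \<le> s\<^sup>2 - 6 + 2" using size s by linarith
  have kpar: "k mod 2 = (t\<^sup>2 + s) mod 2" using k(2) square_parity[of t] by (metis add.commute mod_add_left_eq)
  have sq: "(s + t)\<^sup>2 = s\<^sup>2 + t\<^sup>2 + 2 * t * s" by (simp add: power2_eq_square algebra_simps)
  have ts: "2 * t * s = 2 * t * (s - 2) + 8 * h"
  proof -
    obtain v where "s = v + 2" using le_Suc_ex[of 2 s] s by auto
    then show ?thesis by (simp add: t algebra_simps)
  qed
  show ?thesis
  proof (cases "k \<le> t\<^sup>2 + (s\<^sup>2 - 6) + 2 * t * (s - 2)")
    case True
    obtain j c where *: "j \<le> s - 2" "s \<le> c" "c \<le> s\<^sup>2 - 6" "c mod 2 = s mod 2" "k = t\<^sup>2 + c + 2 * t * j"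
      by (rule window_cover[OF k(1) True _ size' kpar par]) auto
    have "c + 6 \<le> s\<^sup>2" using * size s by linarith
    with * have "c \<in> D_set s" by (auto simp: D_set_def)
    moreover have "j + 2 \<le> s" using * s by linarith
    ultimately show ?thesis using cyc[of c j] D * by (auto simp: add.commute)
  next
    case False
    obtain j c where *: "j \<le> h" "s \<le> c" "c \<le> s\<^sup>2 - 6" "c mod 2 = s mod 2"
      "k = (t\<^sup>2 + 2 * t * (s - 2)) + c + 8 * j"
    proof (rule window_cover[of "t\<^sup>2 + 2 * t * (s - 2)" s k "s\<^sup>2 - 6" 8 h])
      show "k \<le> t\<^sup>2 + 2 * t * (s - 2) + (s\<^sup>2 - 6) + 8 * h" using k(3) sq ts size by linarith
      show "k mod 2 = (t\<^sup>2 + 2 * t * (s - 2) + s) mod 2"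
        using kpar by (metis add.commute add.left_commute mod_mult_self2 mult.assoc)
      show "t\<^sup>2 + 2 * t * (s - 2) + s \<le> k" using False size s by linarith
    qed (use size' s par in auto)
    have "c + 6 \<le> s\<^sup>2" using * size s by linarith
    with * have c: "c \<in> D_set s" by (auto simp: D_set_def)
    have "k + 8 * (h - j) = c + t\<^sup>2 + 2 * t * s" using * ts by simp
    from sw[OF _ _ this] c D show ?thesis by auto
  qed
qed

text \<open>Sums \<open>e\<close> of two values for order \<open>s\<close> fill the parity interval from \<open>2 * s\<close> to
  \<open>2 * s\<^sup>2 - 6\<close>; the agreement of the borders then shifts it by multiples of \<open>2 * s\<close>.\<close>

lemma even_range:
  assumes D: "D_set s \<subseteq> comm_spectrum s" and s: "s \<ge> 6"
    and k: "2 * s \<le> k" "even k" "k + 6 \<le> (2 * s)\<^sup>2"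
  shows "k \<in> comm_spectrum (2 * s)"
proof -
  have ss: "6 * s \<le> s * s" using s by simp
  have sq: "s\<^sup>2 = s * s" by (simp add: power2_eq_square)
  have real: "e + 2 * s * j \<in> comm_spectrum (2 * s)"
    if e: "2 * s \<le> e" "e + 6 \<le> 2 * (s * s)" "even e" and j: "j + 2 \<le> s \<or> j = s" for e j
  proof -
    \<comment> \<open>The larger summand is pushed as high as the two pieces of \<open>D_set s\<close> allow.\<close>
    define c' where "c' = (if e + 6 \<le> s + s * s then e - s else if e + 12 \<le> 2 * (s * s) then s * s - 6 else s * s)"
    define c where "c = e - c'"
    have "c \<in> D_set s \<and> c' \<in> D_set s \<and> c + c' = e"
    proof (cases "e + 6 \<le> s + s * s")
      case True
      then have "c' = e - s" "c = s" using e by (auto simp: c'_def c_def)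
      moreover have "even (e - s) \<longleftrightarrow> even s" using e s by auto
      ultimately show ?thesis using True e ss s by (auto simp: D_set_def sq mod_2_eq_iff)
    next
      case F: False
      show ?thesis
      proof (cases "e + 12 \<le> 2 * (s * s)")
        case True
        with F have c': "c' = s * s - 6" "c = e - (s * s - 6)" by (auto simp: c'_def c_def)
        moreover have "6 \<le> s * s" using ss s by linarith
        then have "even (s * s - 6) \<longleftrightarrow> even s" by auto
        moreover have "even (e - (s * s - 6)) \<longleftrightarrow> even s" using F e ss s by auto
        ultimately show ?thesis using True F e ss s by (auto simp: D_set_def sq mod_2_eq_iff)
      next
        case False
        with F have c': "c' = s * s" "c = e - s * s" by (auto simp: c'_def c_def)
        have "s * s + s \<le> e" using False ss s by linarith
        then obtain d where d: "e = s * s + d" "s \<le> d" by (metis add.assoc le_iff_add)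
        moreover have "even d \<longleftrightarrow> even s" using e d by auto
        moreover have "d + 6 \<le> s * s" using e d by linarith
        ultimately show ?thesis using c' by (auto simp: D_set_def sq mod_2_eq_iff)
      qed
    qed
    then show ?thesis using doubling_spectrum[of c s c' j] D j s by auto
  qed
  have k6: "k + 6 \<le> 4 * (s * s)" using k(3) by (simp add: power2_eq_square)
  show ?thesis
  proof (cases "k \<le> 0 + (2 * (s * s) - 6) + 2 * s * (s - 2)")
    case True
    obtain j e where *: "j \<le> s - 2" "2 * s \<le> e" "e \<le> 2 * (s * s) - 6" "e mod 2 = (2 * s) mod 2"
      "k = 0 + e + 2 * s * j"
    proof (rule window_cover[of 0 "2 * s" k "2 * (s * s) - 6" "2 * s" "s - 2"])
      have "even (2 * (s * s) - 6)" by simp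
      then show "(2 * (s * s) - 6) mod 2 = (2 * s) mod 2" by simp
      show "2 * s + 2 * s \<le> 2 * (s * s) - 6 + 2" using ss s by linarith
    qed (use k True s in auto)
    have "e + 6 \<le> 2 * (s * s)" "j + 2 \<le> s" using * ss s by linarith+
    with real[of e j] * show ?thesis by (auto simp: mod_2_eq_iff)
  next
    case False
    have "2 * s * (s - 2) + 4 * s = 2 * (s * s)"
      using s by (cases s; cases "s - 1") (auto simp: algebra_simps)
    then have "k = (k - 2 * (s * s)) + 2 * s * s" "2 * s \<le> k - 2 * (s * s)" "k - 2 * (s * s) + 6 \<le> 2 * (s * s)"
      using False k6 ss s mult.assoc[of 2 s s] by linarith+
    with real[of "k - 2 * (s * s)" s] k(2) show ?thesis by auto
  qed
qed

lemma matching_high_values: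
  assumes t: "even t" "t \<ge> 6" "t = s + 1" and c: "c \<in> comm_spectrum s"
  shows "j + 2 \<le> s \<or> j = s \<Longrightarrow> c + t\<^sup>2 + 2 * t * j \<in> comm_spectrum (s + t)"
    and "i \<le> t div 2 \<Longrightarrow> k + 8 * i = c + t\<^sup>2 + 2 * t * s \<Longrightarrow> k \<in> comm_spectrum (s + t)"
proof -
  obtain h where h: "t = 2 * h" using t by blast
  have set_eq: "{1..int t - 1} = {1..<1 + int s}" using t by auto
  note fill = matching_filling[of t, unfolded set_eq]
  have h2: "hollow (2 * h) {1..<1 + int s} {1..<1 + int s} (matching_filling (2 * h))"
    and P: "sym_cells (residues (2 * h)) (matching_filling (2 * h)) = (2 * h)\<^sup>2"
    using fill t unfolding h[symmetric] by auto
  have b: "(1::int) \<in> {1..<1 + int s}" "1 + int h \<in> {1..<1 + int s}" "h > 0" using t h by auto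
  have l: "(0::int) \<le> 1" "1 + int s \<le> int (2 * h)" using t h by auto
  show "j + 2 \<le> s \<or> j = s \<Longrightarrow> c + t\<^sup>2 + 2 * t * j \<in> comm_spectrum (s + t)"
    by (rule high_values(1)[OF h2 P l b c h])
  show "i \<le> t div 2 \<Longrightarrow> k + 8 * i = c + t\<^sup>2 + 2 * t * s \<Longrightarrow> k \<in> comm_spectrum (s + t)"
    using high_values(2)[OF h2 P l b c h, of i k] h by simp
qed

lemma cycle_high_values:
  assumes t: "even t" "t \<ge> 8" "t = s + 3" and c: "c \<in> comm_spectrum s"
  shows "j + 2 \<le> s \<or> j = s \<Longrightarrow> c + t\<^sup>2 + 2 * t * j \<in> comm_spectrum (s + t)"
    and "i \<le> t div 2 \<Longrightarrow> k + 8 * i = c + t\<^sup>2 + 2 * t * s \<Longrightarrow> k \<in> comm_spectrum (s + t)"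
proof -
  obtain h where h: "t = 2 * h" using t by blast
  have set_eq: "{2..int t - 2} = {2..<2 + int s}" using t by auto
  note fill = cycle_filling[of t, unfolded set_eq]
  have h2: "hollow (2 * h) {2..<2 + int s} {2..<2 + int s} (cycle_filling (2 * h))"
    and P: "sym_cells (residues (2 * h)) (cycle_filling (2 * h)) = (2 * h)\<^sup>2"
    using fill t unfolding h[symmetric] by auto
  have b: "(2::int) \<in> {2..<2 + int s}" "2 + int h \<in> {2..<2 + int s}" "h > 0" using t h by auto
  have l: "(0::int) \<le> 2" "2 + int s \<le> int (2 * h)" using t h by auto
  show "j + 2 \<le> s \<or> j = s \<Longrightarrow> c + t\<^sup>2 + 2 * t * j \<in> comm_spectrum (s + t)"
    by (rule high_values(1)[OF h2 P l b c h])
  show "i \<le> t div 2 \<Longrightarrow> k + 8 * i = c + t\<^sup>2 + 2 * t * s \<Longrightarrow> k \<in> comm_spectrum (s + t)"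
    using high_values(2)[OF h2 P l b c h, of i k] h by simp
qed

text \<open>For the low values the subsquare has order \<open>s - 1\<close> and \<open>t = s + 2\<close>, for the high ones order
  \<open>s\<close> and \<open>t = s + 1\<close>. A commutative table of odd order has no commutative subsquare of even
  order, which is why the high values need odd \<open>s\<close>.\<close>

lemma range_3_mod_4:
  assumes s: "odd s" "s \<ge> 7" and D: "D_set s \<subseteq> comm_spectrum s"
    and D': "D_set (s - 1) \<subseteq> comm_spectrum (s - 1)"
    and k: "2 * s + 1 \<le> k" "odd k" "k + 6 \<le> (2 * s + 1)\<^sup>2"
  shows "k \<in> comm_spectrum (2 * s + 1)"
proof -
  obtain u where u: "s = u + 1" using le_Suc_ex[of 1 s] s by auto
  have ss: "7 * s \<le> s * s" using s by auto
  have "6 \<le> u" using s u by auto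
  then have uu: "6 * u \<le> u * u" by auto
  have n: "2 * s + 1 = s + (s + 1)" "2 * s + 1 = u + (u + 3)" using u by auto
  show ?thesis
  proof (cases "k + 6 \<le> (u + 3) + u\<^sup>2 + 2 * (u + 3) * (u - 1)")
    case True
    show ?thesis unfolding n(2)
    proof (rule low_range)
      show "c + (u + 3) + 2 * (u + 3) * j \<in> comm_spectrum (u + (u + 3))"
        if "c \<in> comm_spectrum u" "j < u" for c j
        using low_values_3[of "u + 3" u c j] that s u by simp
      show "2 * (u + 3) + u + 4 \<le> u\<^sup>2" 
      proof -
        have "2 * (u + 3) + u + 4 \<le> 6 * u" using \<open>6 \<le> u\<close> by simp
        also have "\<dots> \<le> u\<^sup>2" using uu by (simp only: power2_eq_square)
        finally show ?thesis .
      qed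
      show "k mod 2 = (u + (u + 3)) mod 2" using k(2) by (subst mod_2_eq_iff) simp
    qed (use D' k True s u in \<open>auto simp: mod_2_eq_iff\<close>)
  next
    case False
    obtain v where v: "u = v + 1" using le_Suc_ex[of 1 u] s u by auto
    have "(s + 1)\<^sup>2 + s \<le> (u + 3) + u\<^sup>2 + 2 * (u + 3) * (u - 1) - 6"
    proof -
      have "(u + 3) + u\<^sup>2 + 2 * (u + 3) * (u - 1) + 3 = 3 * (u * u) + 5 * u"
        by (simp add: v power2_eq_square algebra_simps)
      moreover have "(s + 1)\<^sup>2 = u * u + 4 * u + 4"
        by (simp add: u power2_eq_square algebra_simps)
      ultimately show ?thesis using uu s u by linarith
    qed
    then have lo: "(s + 1)\<^sup>2 + s \<le> k" using False by linarith
    show ?thesis unfolding n(1)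
    proof (rule high_range[where h = "(s + 1) div 2"])
      show "c + (s + 1)\<^sup>2 + 2 * (s + 1) * j \<in> comm_spectrum (s + (s + 1))"
        if "c \<in> comm_spectrum s" "j + 2 \<le> s \<or> j = s" for c j
        using matching_high_values(1)[of "s + 1" s c j] that s by simp
      show "k' \<in> comm_spectrum (s + (s + 1))"
        if "c \<in> comm_spectrum s" "i \<le> (s + 1) div 2" "k' + 8 * i = c + (s + 1)\<^sup>2 + 2 * (s + 1) * s" for c i k'
        using matching_high_values(2)[of "s + 1" s c i k'] that s by simp
      show "2 * (s + 1) + s + 4 \<le> s\<^sup>2"
      proof -
        have "2 * (s + 1) + s + 4 \<le> 7 * s" using s(2) by simp
        also have "\<dots> \<le> s\<^sup>2" using ss by (simp only: power2_eq_square)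
        finally show ?thesis .
      qed
      show "k + 6 \<le> (s + (s + 1))\<^sup>2" using k(3) unfolding n(1) .
      show "k mod 2 = (s + (s + 1)) mod 2" using k(2) by (subst mod_2_eq_iff) simp
    qed (use D k s lo in \<open>auto simp: mod_2_eq_iff\<close>)
  qed
qed

text \<open>For the low values the subsquare has order \<open>s + 1\<close> and \<open>t = s + 2\<close>. For the high ones an odd
  \<open>s\<close> and an even \<open>t\<close> are again wanted, and with \<open>t = s + 3\<close> two colours of the one-factorization
  remain over.\<close>

lemma range_1_mod_4:
  assumes s: "odd s" "s \<ge> 7" and D: "D_set s \<subseteq> comm_spectrum s"
    and D': "D_set (s + 1) \<subseteq> comm_spectrum (s + 1)"
    and k: "2 * s + 3 \<le> k" "odd k" "k + 6 \<le> (2 * s + 3)\<^sup>2"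
  shows "k \<in> comm_spectrum (2 * s + 3)"
proof -
  have ss: "7 * s \<le> s * s" using s by auto
  have n: "2 * s + 3 = s + (s + 3)" "2 * s + 3 = (s + 1) + (s + 2)" by auto
  show ?thesis
  proof (cases "k + 6 \<le> (s + 2) + (s + 1)\<^sup>2 + 2 * (s + 2) * (s + 1 - 1)")
    case True
    show ?thesis unfolding n(2)
    proof (rule low_range)
      show "c + (s + 2) + 2 * (s + 2) * j \<in> comm_spectrum ((s + 1) + (s + 2))"
        if "c \<in> comm_spectrum (s + 1)" "j < s + 1" for c j
        using low_values_1[of "s + 2" "s + 1" c j] that s by simp
      show "2 * (s + 2) + (s + 1) + 4 \<le> (s + 1)\<^sup>2"
      proof -
        have "(s + 1)\<^sup>2 = s * s + 2 * s + 1" by (simp add: power2_eq_square)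
        moreover have "2 * (s + 2) + (s + 1) + 4 \<le> 7 * s" using s(2) by simp
        ultimately show ?thesis using le_trans[OF _ ss] by (metis le_trans trans_le_add1)
      qed
      show "k mod 2 = (s + 1 + (s + 2)) mod 2" using k(2) by (subst mod_2_eq_iff) simp
    qed (use D' k True s in \<open>auto simp: mod_2_eq_iff\<close>)
  next
    case False
    have "(s + 3)\<^sup>2 + s + 6 \<le> (s + 2) + (s + 1)\<^sup>2 + 2 * (s + 2) * (s + 1 - 1)"
    proof -
      have "(s + 3)\<^sup>2 = s * s + 6 * s + 9" "(s + 1)\<^sup>2 = s * s + 2 * s + 1"
        "2 * (s + 2) * (s + 1 - 1) = 2 * (s * s) + 4 * s"
        by (simp_all add: power2_eq_square algebra_simps)
      then show ?thesis using ss s by linarith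
    qed
    then have lo: "(s + 3)\<^sup>2 + s \<le> k" using False by linarith
      show ?thesis unfolding n(1)
      proof (rule high_range[where h = "(s + 3) div 2"])
        show "c + (s + 3)\<^sup>2 + 2 * (s + 3) * j \<in> comm_spectrum (s + (s + 3))"
          if "c \<in> comm_spectrum s" "j + 2 \<le> s \<or> j = s" for c j
          using cycle_high_values(1)[of "s + 3" s c j] that s by simp
        show "k' \<in> comm_spectrum (s + (s + 3))"
          if "c \<in> comm_spectrum s" "i \<le> (s + 3) div 2" "k' + 8 * i = c + (s + 3)\<^sup>2 + 2 * (s + 3) * s" for c i k'
          using cycle_high_values(2)[of "s + 3" s c i k'] that s by simp
        show "2 * (s + 3) + s + 4 \<le> s\<^sup>2"
        proof -
          have "2 * (s + 3) + s + 4 \<le> 7 * s" using s(2) by simp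
          also have "\<dots> \<le> s\<^sup>2" using ss by (simp only: power2_eq_square)
          finally show ?thesis .
        qed
        show "k + 6 \<le> (s + (s + 3))\<^sup>2" using k(3) unfolding n(1) .
        show "k mod 2 = (s + (s + 3)) mod 2" using k(2) s(1) by (subst mod_2_eq_iff) simp
      qed (use D k s lo in \<open>auto simp: mod_2_eq_iff\<close>)
  qed
qed

section \<open>Small orders\<close>

definition latin_table :: "nat \<Rightarrow> nat list list \<Rightarrow> bool" where
  "latin_table n T \<longleftrightarrow> length T = n
    \<and> list_all (\<lambda>r. length r = n \<and> distinct r \<and> list_all (\<lambda>x. x < n) r) T
    \<and> list_all (\<lambda>j. distinct (map (\<lambda>r. r ! j) T)) [0..<n]"

definition table_comm :: "nat \<Rightarrow> nat list list \<Rightarrow> nat" where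
  "table_comm n T = sum_list (map (\<lambda>i. length (filter (\<lambda>j. T ! i ! j = T ! j ! i) [0..<n])) [0..<n])"

lemma table_spectrum:
  assumes T: "latin_table n T" and n: "n > 0"
  shows "table_comm n T \<in> comm_spectrum n"
proof -
  let ?m = "\<lambda>i j. T ! i ! j"
  have len: "length T = n" and row: "\<And>i. i < n \<Longrightarrow> length (T ! i) = n \<and> distinct (T ! i) \<and> (\<forall>j<n. T ! i ! j < n)"
    and col: "\<And>j. j < n \<Longrightarrow> distinct (map (\<lambda>r. r ! j) T)"
    using T by (auto simp: latin_table_def list_all_iff) (metis nth_mem)
  have "quasigroup {..<n} ?m"
  proof (rule finite_quasigroupI)
    fix a assume a: "a \<in> {..<n}"
    show "inj_on (?m a) {..<n}"
      by (rule inj_onI) (use a row in \<open>metis lessThan_iff nth_eq_iff_index_eq\<close>)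
    show "inj_on (\<lambda>x. ?m x a) {..<n}"
    proof (rule inj_onI)
      fix x y assume "x \<in> {..<n}" "y \<in> {..<n}" "T ! x ! a = T ! y ! a"
      then show "x = y"
        using nth_eq_iff_index_eq[OF col[of a], of x y] a len by simp
    qed
  qed (use row n in auto)
  then have "comm_pairs {..<n} ?m \<in> comm_spectrum n"
    using comm_pairs_in_comm_spectrum[of "{..<n}" ?m] by simp
  moreover have "comm_pairs {..<n} ?m = table_comm n T"
  proof -
    have "{(x, y). x \<in> {..<n} \<and> y \<in> {..<n} \<and> ?m x y = ?m y x}
        = (SIGMA i:{..<n}. set (filter (\<lambda>j. T ! i ! j = T ! j ! i) [0..<n]))" by auto
    then show ?thesis
      by (simp add: comm_pairs_def table_comm_def distinct_card sum_list_distinct_conv_sum_set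
          lessThan_atLeast0 flip: set_filter)
  qed
  ultimately show ?thesis by simp
qed

text \<open>The tables of each order are listed by increasing number of commuting pairs.\<close>

definition tables_3 :: "nat list list list" where
  "tables_3 = [
    [[0,2,1],[1,0,2],[2,1,0]]]"

lemma tables_3:
  "list_all (latin_table 3) tables_3"
  "map (table_comm 3) tables_3 = [3]"
  by code_simp+

definition tables_4 :: "nat list list list" where
  "tables_4 = [
    [[0,3,1,2],[2,1,3,0],[3,0,2,1],[1,2,0,3]],
    [[1,0,3,2],[2,3,0,1],[3,1,2,0],[0,2,1,3]],
    [[2,0,3,1],[1,3,0,2],[3,1,2,0],[0,2,1,3]],
    [[3,2,1,0],[2,3,0,1],[1,0,2,3],[0,1,3,2]]]"

lemma tables_4:
  "list_all (latin_table 4) tables_4"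
  "map (table_comm 4) tables_4 = [4, 6, 8, 16]"
  by code_simp+

definition tables_5 :: "nat list list list" where
  "tables_5 = [
    [[0,2,1,3,4],[1,0,2,4,3],[3,1,4,2,0],[4,3,0,1,2],[2,4,3,0,1]],
    [[3,0,2,1,4],[2,3,0,4,1],[4,1,3,2,0],[0,4,1,3,2],[1,2,4,0,3]],
    [[0,2,1,3,4],[1,0,2,4,3],[4,3,0,1,2],[3,1,4,2,0],[2,4,3,0,1]],
    [[3,1,4,2,0],[1,0,2,4,3],[4,3,0,1,2],[0,2,1,3,4],[2,4,3,0,1]],
    [[4,2,0,3,1],[3,4,1,0,2],[0,1,2,4,3],[1,3,4,2,0],[2,0,3,1,4]],
    [[3,2,0,1,4],[2,3,4,0,1],[0,4,1,3,2],[4,1,3,2,0],[1,0,2,4,3]],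
    [[3,4,0,1,2],[4,1,2,3,0],[0,2,1,4,3],[2,3,4,0,1],[1,0,3,2,4]],
    [[3,4,1,0,2],[4,0,2,1,3],[1,2,4,3,0],[0,1,3,2,4],[2,3,0,4,1]]]"

lemma tables_5:
  "list_all (latin_table 5) tables_5"
  "map (table_comm 5) tables_5 = [5, 7, 9, 11, 13, 15, 19, 25]"
  by code_simp+

definition tables_6 :: "nat list list list" where
  "tables_6 = [
    [[0,5,3,2,1,4],[3,1,0,4,5,2],[4,2,5,1,0,3],[1,3,4,5,2,0],[5,4,2,0,3,1],[2,0,1,3,4,5]],
    [[5,0,1,3,2,4],[3,1,4,0,5,2],[2,3,5,4,0,1],[4,2,3,5,1,0],[1,4,0,2,3,5],[0,5,2,1,4,3]],
    [[5,0,2,4,3,1],[2,1,3,0,5,4],[3,2,4,1,0,5],[4,3,0,5,1,2],[1,4,5,3,2,0],[0,5,1,2,4,3]],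
    [[5,0,3,1,2,4],[2,1,0,4,5,3],[0,2,4,5,3,1],[4,3,5,2,1,0],[1,4,2,3,0,5],[3,5,1,0,4,2]],
    [[5,4,0,3,2,1],[1,2,3,4,5,0],[3,1,5,2,0,4],[4,0,2,1,3,5],[2,5,4,0,1,3],[0,3,1,5,4,2]],
    [[5,0,1,3,2,4],[0,1,4,2,5,3],[3,2,5,4,0,1],[4,3,2,5,1,0],[2,4,0,1,3,5],[1,5,3,0,4,2]],
    [[2,3,1,4,5,0],[1,2,3,0,4,5],[3,1,2,5,0,4],[5,0,4,3,1,2],[0,4,5,1,2,3],[4,5,0,2,3,1]],
    [[1,4,0,3,2,5],[5,0,3,4,1,2],[0,5,1,2,3,4],[4,3,2,5,0,1],[2,1,4,0,5,3],[3,2,5,1,4,0]],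
    [[0,1,2,5,4,3],[1,2,4,3,0,5],[3,4,1,0,5,2],[5,3,0,2,1,4],[2,0,5,4,3,1],[4,5,3,1,2,0]],
    [[3,5,2,1,0,4],[5,4,3,0,1,2],[0,3,5,4,2,1],[1,0,4,2,3,5],[2,1,0,5,4,3],[4,2,1,3,5,0]],
    [[3,4,5,2,1,0],[4,5,1,3,0,2],[5,2,4,0,3,1],[2,3,0,1,4,5],[1,0,2,4,5,3],[0,1,3,5,2,4]],
    [[3,1,5,0,2,4],[0,4,2,5,1,3],[5,2,0,4,3,1],[1,5,4,3,0,2],[2,0,3,1,4,5],[4,3,1,2,5,0]],
    [[0,3,5,1,4,2],[3,0,2,4,1,5],[5,2,4,0,3,1],[1,4,0,2,5,3],[2,1,3,5,0,4],[4,5,1,3,2,0]],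
    [[4,0,5,3,2,1],[0,4,2,1,3,5],[5,2,0,4,1,3],[3,1,4,5,0,2],[2,3,1,0,5,4],[1,5,3,2,4,0]]]"

lemma tables_6:
  "list_all (latin_table 6) tables_6"
  "map (table_comm 6) tables_6 = [6, 8, 10, 12, 14, 16, 18, 20, 22, 24, 26, 28, 30, 36]"
  by code_simp+

definition tables_7 :: "nat list list list" where
  "tables_7 = [
    [[6,5,2,4,0,3,1],[1,4,5,6,3,0,2],[4,0,1,5,2,6,3],[3,1,0,2,6,5,4],[5,6,3,1,4,2,0],[0,2,4,3,5,1,6],[2,3,6,0,1,4,5]],
    [[3,1,0,5,6,2,4],[4,2,6,3,0,5,1],[6,0,5,4,1,3,2],[2,6,3,1,5,4,0],[1,5,4,0,2,6,3],[5,4,1,2,3,0,6],[0,3,2,6,4,1,5]],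
    [[6,5,0,3,2,4,1],[0,3,4,5,6,1,2],[4,6,2,1,5,0,3],[3,0,6,2,1,5,4],[1,2,3,0,4,6,5],[2,1,5,4,0,3,6],[5,4,1,6,3,2,0]],
    [[6,5,2,3,0,4,1],[5,6,3,0,4,1,2],[4,0,6,1,2,5,3],[3,1,0,5,6,2,4],[1,4,5,2,3,6,0],[0,2,1,4,5,3,6],[2,3,4,6,1,0,5]],
    [[6,5,2,3,0,4,1],[5,6,3,0,4,1,2],[4,0,1,6,2,5,3],[3,1,0,5,6,2,4],[1,4,5,2,3,6,0],[0,2,4,1,5,3,6],[2,3,6,4,1,0,5]],
    [[6,2,5,3,0,4,1],[5,3,6,2,4,1,0],[4,6,0,1,2,5,3],[3,0,1,5,6,2,4],[1,5,4,0,3,6,2],[0,1,2,4,5,3,6],[2,4,3,6,1,0,5]],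
    [[6,5,0,3,2,4,1],[0,3,2,5,6,1,4],[4,6,3,1,5,0,2],[3,0,4,2,1,5,6],[1,2,5,0,4,6,3],[2,1,6,4,0,3,5],[5,4,1,6,3,2,0]],
    [[1,4,2,6,5,3,0],[3,5,6,4,0,2,1],[2,0,4,5,1,6,3],[6,1,5,0,3,4,2],[4,3,0,1,2,5,6],[5,2,1,3,6,0,4],[0,6,3,2,4,1,5]],
    [[1,6,0,3,4,2,5],[6,4,2,0,5,3,1],[2,5,4,6,0,1,3],[5,0,6,1,3,4,2],[0,1,3,5,2,6,4],[3,2,1,4,6,5,0],[4,3,5,2,1,0,6]],
    [[4,6,0,3,1,2,5],[6,4,2,0,5,3,1],[2,5,4,6,0,1,3],[5,0,6,1,3,4,2],[0,1,3,5,2,6,4],[3,2,1,4,6,5,0],[1,3,5,2,4,0,6]],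
    [[0,6,1,2,3,5,4],[3,5,2,6,1,4,0],[1,4,6,5,2,0,3],[2,0,5,4,6,3,1],[6,3,4,0,5,1,2],[5,1,0,3,4,2,6],[4,2,3,1,0,6,5]],
    [[6,5,4,1,3,0,2],[5,3,6,2,4,1,0],[4,6,2,0,1,5,3],[0,2,1,3,5,4,6],[2,4,3,5,0,6,1],[3,1,0,4,6,2,5],[1,0,5,6,2,3,4]],
    [[5,6,0,4,1,3,2],[3,4,2,6,0,5,1],[0,2,3,1,4,6,5],[4,0,1,5,6,2,3],[2,3,4,0,5,1,6],[1,5,6,2,3,4,0],[6,1,5,3,2,0,4]],
    [[6,2,3,4,0,5,1],[2,5,4,0,1,3,6],[3,4,5,6,2,1,0],[4,1,6,3,5,0,2],[5,0,2,1,3,6,4],[0,3,1,2,6,4,5],[1,6,0,5,4,2,3]],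
    [[6,2,3,4,0,5,1],[2,1,4,0,5,3,6],[3,4,5,6,2,1,0],[4,5,6,3,1,0,2],[5,0,2,1,3,6,4],[0,3,1,2,6,4,5],[1,6,0,5,4,2,3]],
    [[6,0,2,1,3,5,4],[5,4,0,6,1,3,2],[2,1,4,5,0,6,3],[1,6,5,3,4,2,0],[3,5,1,4,2,0,6],[0,3,6,2,5,4,1],[4,2,3,0,6,1,5]],
    [[2,1,0,4,3,6,5],[1,0,6,5,4,2,3],[0,6,5,3,1,4,2],[4,5,2,6,0,3,1],[3,4,1,0,2,5,6],[6,3,4,2,5,1,0],[5,2,3,1,6,0,4]],
    [[4,1,6,2,0,3,5],[2,0,1,4,3,5,6],[6,2,3,1,5,4,0],[1,4,2,5,6,0,3],[0,3,5,6,2,1,4],[3,5,4,0,1,6,2],[5,6,0,3,4,2,1]],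
    [[5,6,0,3,2,1,4],[6,0,1,5,4,3,2],[0,1,5,2,6,4,3],[3,5,4,1,0,2,6],[2,4,6,0,3,5,1],[1,3,2,4,5,6,0],[4,2,3,6,1,0,5]],
    [[0,3,5,2,1,6,4],[3,6,1,0,4,5,2],[5,1,2,6,0,4,3],[2,0,6,4,5,3,1],[1,4,0,5,3,2,6],[6,5,4,3,2,1,0],[4,2,3,1,6,0,5]]]"

lemma tables_7:
  "list_all (latin_table 7) tables_7"
  "map (table_comm 7) tables_7 = [7, 9, 11, 13, 15, 17, 19, 21, 23, 25, 27, 29, 31, 33, 35, 37, 39, 41, 43, 49]"
  by code_simp+

definition tables_8 :: "nat list list list" where
  "tables_8 = [
    [[5,0,6,1,4,7,2,3],[4,3,7,2,0,5,1,6],[7,6,5,0,1,4,3,2],[1,2,0,6,7,3,4,5],[2,7,1,3,6,0,5,4],[3,5,4,7,2,6,0,1],[6,1,3,4,5,2,7,0],[0,4,2,5,3,1,6,7]],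
    [[5,0,3,4,2,1,6,7],[0,3,6,7,4,5,1,2],[3,6,7,0,5,4,2,1],[7,4,0,1,6,2,5,3],[2,1,5,6,3,0,7,4],[1,5,4,2,0,7,3,6],[6,7,2,5,1,3,4,0],[4,2,1,3,7,6,0,5]],
    [[2,6,5,3,7,1,4,0],[6,1,2,4,5,0,7,3],[5,2,7,6,0,4,3,1],[3,4,6,0,1,5,2,7],[7,5,0,1,4,3,6,2],[1,7,4,5,3,2,0,6],[4,0,3,2,6,7,1,5],[0,3,1,7,2,6,5,4]]]"

lemma tables_8:
  "list_all (latin_table 8) tables_8"
  "map (table_comm 8) tables_8 = [34, 50, 58]"
  by code_simp+

definition tables_9 :: "nat list list list" where
  "tables_9 = [
    [[5,8,6,1,4,3,0,2,7],[1,6,4,0,3,5,2,7,8],[2,5,1,8,7,4,3,0,6],[4,7,2,5,6,1,8,3,0],[3,2,8,7,5,0,6,4,1],[0,3,7,6,1,8,4,5,2],[7,1,0,3,8,2,5,6,4],[8,4,5,2,0,6,7,1,3],[6,0,3,4,2,7,1,8,5]],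
    [[2,3,7,5,0,4,1,8,6],[0,2,5,3,8,6,7,4,1],[8,4,3,2,1,0,6,7,5],[7,5,6,8,3,1,4,2,0],[4,1,0,7,6,8,5,3,2],[6,8,1,0,7,3,2,5,4],[5,0,4,6,2,7,3,1,8],[3,6,2,1,4,5,8,0,7],[1,7,8,4,5,2,0,6,3]],
    [[2,1,7,5,0,4,3,8,6],[0,7,5,3,8,6,2,4,1],[8,6,3,2,1,0,4,7,5],[7,4,6,8,3,1,5,2,0],[4,5,0,7,6,8,1,3,2],[6,2,1,0,7,3,8,5,4],[5,3,4,6,2,7,0,1,8],[3,8,2,1,4,5,6,0,7],[1,0,8,4,5,2,7,6,3]],
    [[2,5,7,1,0,4,3,8,6],[0,7,5,3,8,6,2,4,1],[8,3,4,6,2,7,5,1,0],[7,4,6,8,3,1,0,2,5],[3,1,2,5,4,8,6,0,7],[6,2,1,0,7,3,8,5,4],[5,6,3,2,1,0,4,7,8],[4,8,0,7,6,5,1,3,2],[1,0,8,4,5,2,7,6,3]],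
    [[2,7,5,1,0,4,3,8,6],[0,5,7,3,8,6,2,4,1],[8,3,4,6,2,7,5,1,0],[7,4,6,8,3,1,0,2,5],[3,1,2,5,4,8,6,0,7],[6,2,1,0,7,3,8,5,4],[5,6,3,2,1,0,4,7,8],[1,8,0,4,6,5,7,3,2],[4,0,8,7,5,2,1,6,3]],
    [[2,7,5,1,0,3,4,8,6],[0,5,7,3,8,6,2,4,1],[8,4,3,6,2,7,5,1,0],[7,3,6,8,4,1,0,2,5],[4,1,2,5,3,8,6,0,7],[6,2,1,0,7,4,8,5,3],[5,6,8,2,1,0,3,7,4],[1,8,0,4,6,5,7,3,2],[3,0,4,7,5,2,1,6,8]],
    [[4,0,6,5,2,8,3,1,7],[0,4,5,2,1,7,6,3,8],[1,5,4,7,3,6,8,2,0],[6,8,7,1,0,3,2,4,5],[3,2,0,6,7,1,5,8,4],[2,7,3,8,5,4,1,0,6],[5,1,2,4,8,0,7,6,3],[7,3,8,0,6,2,4,5,1],[8,6,1,3,4,5,0,7,2]],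
    [[0,4,1,5,2,3,8,6,7],[4,0,5,8,1,7,6,3,2],[6,5,4,7,8,1,3,2,0],[5,3,7,6,0,8,2,4,1],[8,2,0,1,3,6,7,5,4],[7,8,3,0,5,2,4,1,6],[1,6,2,4,7,0,5,8,3],[2,7,8,3,6,4,1,0,5],[3,1,6,2,4,5,0,7,8]],
    [[2,0,4,7,5,3,1,8,6],[0,5,7,3,8,6,2,4,1],[8,4,3,6,2,7,5,1,0],[7,3,6,8,4,1,0,2,5],[4,1,2,5,3,8,6,0,7],[6,2,1,0,7,4,8,5,3],[5,6,8,2,1,0,3,7,4],[1,8,0,4,6,5,7,3,2],[3,7,5,1,0,2,4,6,8]],
    [[2,0,4,7,5,3,1,8,6],[0,5,8,3,7,6,2,4,1],[8,4,3,6,2,7,5,1,0],[7,3,6,8,4,1,0,2,5],[4,1,2,5,3,8,6,0,7],[6,2,7,0,1,4,8,5,3],[5,6,1,2,8,0,3,7,4],[1,8,0,4,6,5,7,3,2],[3,7,5,1,0,2,4,6,8]],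
    [[2,0,4,7,5,3,1,8,6],[0,5,8,3,7,6,2,4,1],[8,4,3,6,2,7,5,1,0],[7,3,6,0,4,1,8,2,5],[4,1,2,5,3,8,6,0,7],[6,2,7,8,1,4,0,5,3],[5,6,1,2,8,0,3,7,4],[1,8,0,4,6,5,7,3,2],[3,7,5,1,0,2,4,6,8]],
    [[8,7,2,6,5,1,3,4,0],[4,1,3,0,8,6,7,5,2],[3,6,8,7,4,5,2,0,1],[6,0,1,2,7,4,5,3,8],[1,4,7,5,6,8,0,2,3],[5,3,0,4,1,2,8,7,6],[2,8,5,1,0,3,4,6,7],[0,5,6,3,2,7,1,8,4],[7,2,4,8,3,0,6,1,5]],
    [[2,0,4,7,5,3,6,8,1],[0,5,8,3,7,1,2,4,6],[8,4,3,1,2,7,5,6,0],[7,3,1,0,4,6,8,2,5],[4,7,5,6,3,2,1,0,8],[6,2,7,8,1,4,0,5,3],[5,1,6,2,8,0,3,7,4],[1,8,0,4,6,5,7,3,2],[3,6,2,5,0,8,4,1,7]],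
    [[4,7,1,3,5,6,2,8,0],[7,5,3,8,6,4,0,2,1],[1,6,0,2,8,3,7,5,4],[8,3,5,1,0,2,4,6,7],[6,4,8,0,2,7,3,1,5],[3,2,6,5,7,0,1,4,8],[5,8,7,4,3,1,6,0,2],[2,0,4,7,1,5,8,3,6],[0,1,2,6,4,8,5,7,3]],
    [[5,7,2,3,8,1,6,0,4],[0,1,6,4,5,3,7,8,2],[2,5,8,1,4,6,0,3,7],[3,4,1,2,7,0,8,6,5],[1,0,7,8,3,5,4,2,6],[8,6,4,0,1,2,5,7,3],[6,3,5,7,0,8,2,4,1],[4,8,3,6,2,7,1,5,0],[7,2,0,5,6,4,3,1,8]],
    [[0,8,4,1,7,2,3,6,5],[8,5,1,2,4,6,0,3,7],[4,6,2,8,0,7,1,5,3],[2,7,8,4,3,0,5,1,6],[7,4,0,3,6,5,8,2,1],[3,0,7,5,1,4,6,8,2],[1,2,6,7,5,3,4,0,8],[6,3,5,0,8,1,2,7,4],[5,1,3,6,2,8,7,4,0]],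
    [[8,2,1,4,6,3,7,0,5],[1,4,3,7,5,2,8,6,0],[0,1,7,5,4,8,3,2,6],[4,3,6,2,7,0,5,8,1],[5,7,4,0,1,6,2,3,8],[3,0,8,6,2,1,4,5,7],[7,8,5,3,0,4,6,1,2],[2,6,0,8,3,5,1,7,4],[6,5,2,1,8,7,0,4,3]],
    [[5,1,4,6,3,2,0,8,7],[3,7,2,5,8,4,1,6,0],[4,2,1,8,6,0,7,3,5],[7,5,0,3,2,1,6,4,8],[1,8,3,2,7,5,4,0,6],[2,0,6,1,5,3,8,7,4],[6,3,7,0,4,8,5,1,2],[8,6,5,4,0,7,3,2,1],[0,4,8,7,1,6,2,5,3]],
    [[8,2,1,4,5,3,7,0,6],[1,4,3,7,0,2,8,6,5],[0,1,7,5,6,8,3,2,4],[4,7,6,2,3,0,5,8,1],[5,3,4,0,1,6,2,7,8],[3,0,8,6,7,1,4,5,2],[7,8,5,3,2,4,6,1,0],[2,6,0,8,4,5,1,3,7],[6,5,2,1,8,7,0,4,3]],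
    [[3,8,6,2,1,0,5,7,4],[8,2,1,7,0,3,6,4,5],[6,1,4,0,5,7,3,2,8],[0,4,8,6,3,5,7,1,2],[1,6,5,3,8,4,2,0,7],[2,3,7,5,6,1,4,8,0],[7,0,3,4,2,6,8,5,1],[5,7,2,1,4,8,0,6,3],[4,5,0,8,7,2,1,3,6]],
    [[4,1,5,0,6,7,2,8,3],[1,4,6,3,5,2,0,7,8],[3,8,0,2,1,6,7,4,5],[0,3,8,5,7,4,1,6,2],[6,5,1,7,0,3,8,2,4],[5,2,7,8,3,1,4,0,6],[2,0,3,1,4,8,6,5,7],[8,7,4,6,2,0,5,3,1],[7,6,2,4,8,5,3,1,0]],
    [[1,4,7,2,3,5,6,0,8],[3,5,8,4,2,0,7,6,1],[7,8,2,6,1,4,0,5,3],[2,3,6,1,0,8,5,4,7],[0,2,1,3,7,6,4,8,5],[5,0,3,8,4,2,1,7,6],[8,7,4,5,6,1,2,3,0],[4,6,5,0,8,7,3,1,2],[6,1,0,7,5,3,8,2,4]],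
    [[0,1,2,5,4,3,6,7,8],[1,2,5,4,3,6,7,8,0],[2,0,4,3,5,7,8,6,1],[5,4,3,6,7,8,0,1,2],[4,5,6,7,8,2,1,0,3],[3,6,7,8,0,1,5,2,4],[6,7,8,2,1,0,3,4,5],[7,8,0,1,2,5,4,3,6],[8,3,1,0,6,4,2,5,7]],
    [[1,4,7,8,3,5,6,0,2],[3,5,2,0,8,4,7,6,1],[7,2,8,6,1,0,4,5,3],[8,3,6,1,0,2,5,4,7],[4,8,1,3,7,6,0,2,5],[5,0,3,2,4,8,1,7,6],[2,7,4,5,6,1,8,3,0],[0,6,5,4,2,7,3,1,8],[6,1,0,7,5,3,2,8,4]],
    [[5,3,2,7,1,4,0,6,8],[6,8,0,4,3,1,5,2,7],[2,0,6,5,8,7,4,3,1],[7,1,5,0,6,2,8,4,3],[3,6,8,1,5,0,2,7,4],[1,4,7,2,0,8,3,5,6],[0,7,4,8,2,3,6,1,5],[4,2,3,6,7,5,1,8,0],[8,5,1,3,4,6,7,0,2]],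
    [[7,4,0,5,8,3,1,2,6],[8,6,2,4,3,5,7,1,0],[4,3,6,0,1,2,5,8,7],[0,5,4,1,2,7,3,6,8],[3,8,1,2,5,6,0,7,4],[5,2,3,7,6,4,8,0,1],[1,7,5,3,0,8,6,4,2],[2,1,8,6,7,0,4,5,3],[6,0,7,8,4,1,2,3,5]],
    [[5,1,8,3,4,2,7,6,0],[3,7,4,0,5,1,6,2,8],[2,0,7,8,1,5,3,4,6],[8,3,0,7,2,6,1,5,4],[4,5,1,2,6,0,8,7,3],[1,2,5,6,0,3,4,8,7],[7,6,3,1,8,4,5,0,2],[6,4,2,5,7,8,0,3,1],[0,8,6,4,3,7,2,1,5]],
    [[1,5,2,8,6,7,4,3,0],[5,2,1,3,7,0,8,6,4],[2,7,4,5,0,6,3,1,8],[8,3,5,0,4,1,6,7,2],[0,1,7,4,3,8,5,2,6],[7,0,6,1,8,5,2,4,3],[4,8,3,6,5,2,1,0,7],[3,6,8,7,2,4,0,5,1],[6,4,0,2,1,3,7,8,5]],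
    [[8,5,7,0,2,3,6,1,4],[5,8,6,7,0,2,4,3,1],[2,6,1,8,7,0,5,4,3],[0,7,8,1,3,4,2,5,6],[4,0,2,3,5,8,1,6,7],[3,2,0,4,6,1,7,8,5],[6,4,5,2,1,7,3,0,8],[1,3,4,5,8,6,0,7,2],[7,1,3,6,4,5,8,2,0]],
    [[4,7,6,2,1,5,0,3,8],[7,2,8,6,5,4,3,1,0],[6,8,0,1,7,3,5,2,4],[2,6,1,5,3,0,8,4,7],[1,5,4,8,6,2,7,0,3],[5,4,3,0,2,7,1,8,6],[0,3,5,7,8,1,4,6,2],[3,1,2,4,0,8,6,7,5],[8,0,7,3,4,6,2,5,1]],
    [[3,7,6,0,1,5,2,4,8],[7,0,8,6,5,4,3,1,2],[6,8,2,1,7,3,5,0,4],[0,6,1,5,4,2,8,3,7],[1,5,4,8,6,0,7,2,3],[5,4,3,2,0,7,1,8,6],[2,3,5,7,8,1,4,6,0],[4,1,0,3,2,8,6,7,5],[8,2,7,4,3,6,0,5,1]],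
    [[1,8,7,0,5,4,6,2,3],[8,7,1,2,0,6,3,4,5],[7,1,6,5,4,8,0,3,2],[0,2,5,4,3,7,1,8,6],[6,0,4,3,1,2,7,5,8],[4,6,8,7,2,3,5,1,0],[2,3,0,1,7,5,8,6,4],[5,4,3,8,6,1,2,0,7],[3,5,2,6,8,0,4,7,1]],
    [[0,3,5,2,8,1,7,6,4],[3,8,7,5,2,0,1,4,6],[5,7,6,4,1,3,0,8,2],[2,5,4,7,3,8,6,1,0],[8,2,1,0,4,6,5,3,7],[1,0,3,8,6,2,4,7,5],[7,1,0,6,5,4,3,2,8],[6,4,8,1,0,7,2,5,3],[4,6,2,3,7,5,8,0,1]],
    [[4,6,8,2,7,0,5,1,3],[6,7,0,1,3,8,4,2,5],[8,0,5,7,1,4,2,3,6],[2,1,7,0,4,6,3,5,8],[7,3,1,4,6,5,8,0,2],[0,2,4,6,5,3,1,8,7],[5,4,2,3,8,1,6,7,0],[1,8,3,5,0,2,7,6,4],[3,5,6,8,2,7,0,4,1]],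
    [[1,5,2,3,8,7,6,0,4],[5,7,6,0,4,2,1,3,8],[2,6,0,5,3,8,7,4,1],[3,0,5,4,1,6,2,8,7],[8,4,3,1,2,5,0,7,6],[7,2,8,6,5,3,4,1,0],[6,1,7,2,0,4,8,5,3],[0,3,4,8,7,1,5,6,2],[4,8,1,7,6,0,3,2,5]]]"

lemma tables_9:
  "list_all (latin_table 9) tables_9"
  "map (table_comm 9) tables_9 = [9, 11, 13, 15, 17, 19, 21, 23, 25, 27, 29, 31, 33, 35, 37, 39, 41, 43, 45, 47, 49, 51, 53, 55, 57, 59, 61, 63, 65, 67, 69, 71, 73, 75, 81]"
  by code_simp+

definition tables_10 :: "nat list list list" where
  "tables_10 = [
    [[0,4,9,2,6,5,1,3,7,8],[4,5,3,0,2,6,8,1,9,7],[9,3,1,4,5,7,2,8,6,0],[2,0,4,6,9,8,7,5,1,3],[6,2,5,9,8,4,3,7,0,1],[5,6,7,8,4,1,0,2,3,9],[1,8,2,7,0,3,6,9,5,4],[3,1,8,5,7,2,9,0,4,6],[7,9,6,1,3,0,5,4,8,2],[8,7,0,3,1,9,4,6,2,5]]]"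

lemma tables_10:
  "list_all (latin_table 10) tables_10"
  "map (table_comm 10) tables_10 = [92]"
  by code_simp+

definition tables_11 :: "nat list list list" where
  "tables_11 = [
    [[0,8,10,6,9,3,2,1,4,5,7],[6,5,9,10,7,2,3,0,1,4,8],[3,6,8,0,4,5,7,9,2,1,10],[5,9,1,2,10,7,6,3,8,0,4],[4,7,6,3,0,1,10,8,5,9,2],[2,1,4,8,6,9,5,10,0,7,3],[10,0,5,7,1,8,4,2,6,3,9],[7,10,0,9,8,4,1,6,3,2,5],[1,3,7,5,2,6,9,4,10,8,0],[8,2,3,4,5,10,0,7,9,6,1],[9,4,2,1,3,0,8,5,7,10,6]],
    [[0,8,10,5,7,1,2,3,6,4,9],[4,6,3,2,5,9,1,0,10,7,8],[1,4,8,7,2,3,5,6,0,9,10],[3,0,9,8,10,5,6,7,2,1,4],[6,7,4,10,1,8,0,5,9,3,2],[9,1,5,4,0,10,8,2,7,6,3],[10,9,6,3,4,2,7,8,5,0,1],[7,2,0,6,8,4,9,1,3,10,5],[2,3,7,1,9,0,4,10,8,5,6],[8,5,1,0,3,6,10,9,4,2,7],[5,10,2,9,6,7,3,4,1,8,0]],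
    [[2,8,10,1,7,0,4,3,6,5,9],[4,6,3,2,5,9,1,0,10,7,8],[1,4,8,7,2,3,5,6,0,9,10],[3,0,9,8,10,5,6,7,2,1,4],[6,7,4,10,1,8,0,5,9,3,2],[9,1,5,4,0,10,8,2,7,6,3],[10,9,6,3,4,2,7,8,5,0,1],[7,2,0,6,8,4,9,1,3,10,5],[0,3,7,5,9,1,2,10,8,4,6],[8,5,1,0,3,6,10,9,4,2,7],[5,10,2,9,6,7,3,4,1,8,0]],
    [[0,1,3,8,10,4,6,9,2,5,7],[9,0,6,5,3,10,1,2,4,7,8],[8,2,5,4,7,6,3,0,1,9,10],[10,5,8,6,9,1,2,4,7,0,3],[5,9,4,7,6,3,0,1,10,8,2],[4,6,2,1,0,8,7,3,5,10,9],[3,8,1,0,2,7,5,10,9,6,4],[2,4,10,9,5,0,8,7,3,1,6],[1,10,7,3,4,5,9,6,8,2,0],[6,7,9,10,1,2,4,8,0,3,5],[7,3,0,2,8,9,10,5,6,4,1]],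
    [[4,9,7,5,1,8,0,3,10,6,2],[9,0,10,2,8,4,3,5,7,1,6],[6,8,1,3,10,7,2,9,4,0,5],[7,2,3,6,9,10,4,0,5,8,1],[10,7,5,1,0,6,9,4,8,2,3],[8,5,9,7,6,1,10,2,3,4,0],[1,4,6,0,7,9,5,10,2,3,8],[2,3,8,10,4,5,6,1,0,9,7],[3,1,4,8,2,0,7,6,9,5,10],[0,10,2,4,5,3,1,8,6,7,9],[5,6,0,9,3,2,8,7,1,10,4]],
    [[4,8,1,3,6,5,10,7,9,0,2],[7,2,4,9,0,8,5,1,6,10,3],[5,9,6,0,4,2,3,8,10,1,7],[2,6,7,1,8,10,0,5,4,3,9],[6,3,10,8,1,4,7,9,5,2,0],[8,7,5,10,3,1,2,4,0,9,6],[10,0,3,4,9,6,8,2,1,7,5],[9,10,8,2,7,0,4,6,3,5,1],[0,4,2,6,5,9,1,3,7,8,10],[3,1,0,5,2,7,9,10,8,6,4],[1,5,9,7,10,3,6,0,2,4,8]]]"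

lemma tables_11:
  "list_all (latin_table 11) tables_11"
  "map (table_comm 11) tables_11 = [17, 19, 21, 31, 33, 35]"
  by code_simp+

text \<open>An executable form, for checking coverage of the small orders.\<close>

lemma D_set_list: "D_set n = set (n\<^sup>2 # filter (\<lambda>k. k mod 2 = n mod 2) [n..<n\<^sup>2 - 5])"
  by (auto simp: D_set_def)

lemma tables_spectrum:
  assumes "list_all (latin_table n) Ts" "map (table_comm n) Ts = ks" "n > 0"
  shows "set ks \<subseteq> comm_spectrum n"
  using assms table_spectrum by (auto simp: list_all_iff)

lemma tables_subset:
  "{3} \<subseteq> comm_spectrum 3"
  "set [4, 6, 8, 16] \<subseteq> comm_spectrum 4"
  "set [5, 7, 9, 11, 13, 15, 19, 25] \<subseteq> comm_spectrum 5"
  "D_set 6 \<subseteq> comm_spectrum 6"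
  "D_set 7 \<subseteq> comm_spectrum 7"
  "set [34, 50, 58] \<subseteq> comm_spectrum 8"
  "D_set 9 \<subseteq> comm_spectrum 9"
  "92 \<in> comm_spectrum 10"
  "set [17, 19, 21, 31, 33, 35] \<subseteq> comm_spectrum 11"
proof -
  show "{3} \<subseteq> comm_spectrum 3" using tables_spectrum[OF tables_3] by simp
  show "set [4, 6, 8, 16] \<subseteq> comm_spectrum 4" by (rule tables_spectrum[OF tables_4]) simp
  show "set [5, 7, 9, 11, 13, 15, 19, 25] \<subseteq> comm_spectrum 5"
    by (rule tables_spectrum[OF tables_5]) simp
  have "D_set 6 \<subseteq> set [6, 8, 10, 12, 14, 16, 18, 20, 22, 24, 26, 28, 30, 36]"
    unfolding D_set_list by code_simp
  also have "\<dots> \<subseteq> comm_spectrum 6" by (rule tables_spectrum[OF tables_6]) simp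
  finally show "D_set 6 \<subseteq> comm_spectrum 6" .
  have "D_set 7 \<subseteq> set [7, 9, 11, 13, 15, 17, 19, 21, 23, 25, 27, 29, 31, 33, 35, 37, 39, 41, 43, 49]"
    unfolding D_set_list by code_simp
  also have "\<dots> \<subseteq> comm_spectrum 7" by (rule tables_spectrum[OF tables_7]) simp
  finally show "D_set 7 \<subseteq> comm_spectrum 7" .
  show "set [34, 50, 58] \<subseteq> comm_spectrum 8" by (rule tables_spectrum[OF tables_8]) simp
  have "D_set 9 \<subseteq> set [9, 11, 13, 15, 17, 19, 21, 23, 25, 27, 29, 31, 33, 35, 37, 39, 41, 43, 45,
    47, 49, 51, 53, 55, 57, 59, 61, 63, 65, 67, 69, 71, 73, 75, 81]"
    unfolding D_set_list by code_simp
  also have "\<dots> \<subseteq> comm_spectrum 9" by (rule tables_spectrum[OF tables_9]) simp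
  finally show "D_set 9 \<subseteq> comm_spectrum 9" .
  show "92 \<in> comm_spectrum 10" using tables_spectrum[OF tables_10] by simp
  show "set [17, 19, 21, 31, 33, 35] \<subseteq> comm_spectrum 11"
    by (rule tables_spectrum[OF tables_11]) simp
qed

text \<open>The orders \<open>8\<close>, \<open>10\<close>, \<open>11\<close> and \<open>13\<close> are built from subsquares of order \<open>4\<close>, \<open>5\<close> and \<open>6\<close>. The
  spectra of the orders \<open>4\<close> and \<open>5\<close> have gaps, so the general interval arguments do not apply
  and the values are checked one by one; the few that are missed come from explicit tables.\<close>

lemma D_set_8: "D_set 8 \<subseteq> comm_spectrum 8"
proof
  fix k assume k: "k \<in> D_set 8"
  have "\<forall>k\<in>D_set 8. k \<in> set [34, 50, 58] \<or>
    (\<exists>c\<in>set [4, 6, 8, 16]. \<exists>c'\<in>set [4, 6, 8, 16]. \<exists>j\<in>set [0, 1, 2, 4]. k = c + c' + 2 * 4 * j)"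
    unfolding D_set_list by code_simp
  from bspec[OF this k] show "k \<in> comm_spectrum 8"
  proof (elim disjE bexE)
    fix c c' j :: nat
    assume c: "c \<in> set [4, 6, 8, 16]" "c' \<in> set [4, 6, 8, 16]" and j: "j \<in> set [0, 1, 2, 4]"
      and k: "k = c + c' + 2 * 4 * j"
    have "j + 2 \<le> 4 \<or> j = 4" using j by auto
    from doubling_spectrum[OF subsetD[OF tables_subset(2) c(1)] subsetD[OF tables_subset(2) c(2)] _ this]
    show ?thesis unfolding k by simp
  qed (rule subsetD[OF tables_subset(6)])
qed

lemma D_set_10: "D_set 10 \<subseteq> comm_spectrum 10"
proof
  let ?S = "set [5, 7, 9, 11, 13, 15, 19, 25] :: nat set"
  fix k assume k: "k \<in> D_set 10"
  have "\<forall>k\<in>D_set 10. k = 92 \<or>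
    (\<exists>c\<in>?S. \<exists>c'\<in>?S. \<exists>j\<in>set [0, 1, 2, 3, 5]. k = c + c' + 2 * 5 * j)"
    unfolding D_set_list by code_simp
  from bspec[OF this k] show "k \<in> comm_spectrum 10"
  proof (elim disjE bexE)
    fix c c' j :: nat
    assume c: "c \<in> ?S" "c' \<in> ?S" and j: "j \<in> set [0, 1, 2, 3, 5]" and k: "k = c + c' + 2 * 5 * j"
    have "j + 2 \<le> 5 \<or> j = 5" using j by auto
    from doubling_spectrum[OF subsetD[OF tables_subset(3) c(1)] subsetD[OF tables_subset(3) c(2)] _ this]
    show ?thesis unfolding k by simp
  qed (simp add: tables_subset(8))
qed

lemma D_set_11: "D_set 11 \<subseteq> comm_spectrum 11"
proof
  let ?S = "set [5, 7, 9, 11, 13, 15, 19, 25] :: nat set"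
  fix k assume k: "k \<in> D_set 11"
  have "\<forall>k\<in>D_set 11. k \<in> set [17, 19, 21, 31, 33, 35] \<or>
    (\<exists>c\<in>set [4, 6, 8, 16]. \<exists>j\<in>set [0, 1, 2, 3]. k = c + 7 + 2 * 7 * j) \<or>
    (\<exists>c\<in>?S. \<exists>j\<in>set [0, 1, 2, 3, 5]. k = c + 6\<^sup>2 + 2 * 6 * j) \<or>
    (\<exists>c\<in>?S. \<exists>i\<in>set [0, 1, 2, 3]. k + 8 * i = c + 6\<^sup>2 + 2 * 6 * 5)"
    unfolding D_set_list by code_simp
  from bspec[OF this k] show "k \<in> comm_spectrum 11"
  proof (elim disjE bexE)
    fix c j :: nat
    assume c: "c \<in> set [4, 6, 8, 16]" and j: "j \<in> set [0, 1, 2, 3]" and k: "k = c + 7 + 2 * 7 * j"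
    have "j < 4" using j by auto
    have "c + 7 + 2 * 7 * j \<in> comm_spectrum (4 + 7)"
      by (rule low_values_3[OF _ _ _ subsetD[OF tables_subset(2) c] \<open>j < 4\<close>]) simp_all
    then show ?thesis by (simp only: k) simp
  next
    fix c j :: nat
    assume c: "c \<in> ?S" and j: "j \<in> set [0, 1, 2, 3, 5]" and k: "k = c + 6\<^sup>2 + 2 * 6 * j"
    have "j + 2 \<le> 5 \<or> j = 5" using j by auto
    then have "c + 6\<^sup>2 + 2 * 6 * j \<in> comm_spectrum (5 + 6)"
      by (intro matching_high_values(1) subsetD[OF tables_subset(3) c]) simp_all
    then show ?thesis by (simp only: k) simp
  next
    fix c i :: nat
    assume c: "c \<in> ?S" and i: "i \<in> set [0, 1, 2, 3]" and k: "k + 8 * i = c + 6\<^sup>2 + 2 * 6 * 5"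
    have "i \<le> 6 div 2" using i by auto
    then have "k \<in> comm_spectrum (5 + 6)"
      by (intro matching_high_values(2)[OF _ _ _ subsetD[OF tables_subset(3) c] _ k]) simp_all
    then show ?thesis by simp
  qed (rule subsetD[OF tables_subset(9)])
qed

lemma D_set_13: "D_set 13 \<subseteq> comm_spectrum 13"
proof
  let ?S = "set [5, 7, 9, 11, 13, 15, 19, 25] :: nat set"
  fix k assume k: "k \<in> D_set 13"
  have "\<forall>k\<in>D_set 13.
    (\<exists>c\<in>D_set 6. \<exists>j\<in>set [0, 1, 2, 3, 4, 5]. k = c + 7 + 2 * 7 * j) \<or>
    (\<exists>c\<in>?S. \<exists>j\<in>set [0, 1, 2, 3, 5]. k = c + 8\<^sup>2 + 2 * 8 * j) \<or>
    (\<exists>c\<in>?S. \<exists>i\<in>set [0, 1, 2, 3, 4]. k + 8 * i = c + 8\<^sup>2 + 2 * 8 * 5)"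
    unfolding D_set_list by code_simp
  from bspec[OF this k] show "k \<in> comm_spectrum 13"
  proof (elim disjE bexE)
    fix c j :: nat
    assume c: "c \<in> D_set 6" and j: "j \<in> set [0, 1, 2, 3, 4, 5]" and k: "k = c + 7 + 2 * 7 * j"
    have "j < 6" using j by auto
    have "c + 7 + 2 * 7 * j \<in> comm_spectrum (6 + 7)"
      by (rule low_values_1[OF _ _ _ subsetD[OF tables_subset(4) c] \<open>j < 6\<close>]) simp_all
    then show ?thesis by (simp only: k) simp
  next
    fix c j :: nat
    assume c: "c \<in> ?S" and j: "j \<in> set [0, 1, 2, 3, 5]" and k: "k = c + 8\<^sup>2 + 2 * 8 * j"
    have "j + 2 \<le> 5 \<or> j = 5" using j by auto
    then have "c + 8\<^sup>2 + 2 * 8 * j \<in> comm_spectrum (5 + 8)"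
      by (intro cycle_high_values(1) subsetD[OF tables_subset(3) c]) simp_all
    then show ?thesis by (simp only: k) simp
  next
    fix c i :: nat
    assume c: "c \<in> ?S" and i: "i \<in> set [0, 1, 2, 3, 4]" and k: "k + 8 * i = c + 8\<^sup>2 + 2 * 8 * 5"
    have "i \<le> 8 div 2" using i by auto
    then have "k \<in> comm_spectrum (5 + 8)"
      by (intro cycle_high_values(2)[OF _ _ _ subsetD[OF tables_subset(3) c] _ k]) simp_all
    then show ?thesis by simp
  qed
qed

section \<open>The spectrum of every order\<close>

lemma D_set_subset:
  assumes "n \<ge> 6"
  shows "D_set n \<subseteq> comm_spectrum n"
  using assms
proof (induction n rule: less_induct)
  case (less n)
  have small: ?case if "n \<in> {6, 7, 8, 9, 10, 11, 13}"
    using that tables_subset D_set_8 D_set_10 D_set_11 D_set_13 by auto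
  show ?case
  proof (cases "n \<in> {6, 7, 8, 9, 10, 11, 13}")
    case False
    with less.prems have n: "n = 12 \<or> n \<ge> 14" by auto
    show ?thesis
    proof
      fix k assume "k \<in> D_set n"
      then consider "k = n\<^sup>2" | "k mod 2 = n mod 2" "n \<le> k" "k + 6 \<le> n\<^sup>2" by (auto simp: D_set_def)
      then show "k \<in> comm_spectrum n"
      proof cases
        case 1
        with square_in_spectrum[of n] less.prems show ?thesis by simp
      next
        case 2
        have "even n \<or> n mod 4 = 3 \<or> n mod 4 = 1" by presburger
        then consider "even n" | "n mod 4 = 3" | "n mod 4 = 1" by blast
        then show ?thesis
        proof cases
          case A: 1
          then obtain s where s: "n = 2 * s" by blast
          have "s \<ge> 6" using s n by auto
          then have "D_set s \<subseteq> comm_spectrum s" using less.IH[of s] s by simp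
          then show ?thesis
            using even_range[of s k] 2 n by (auto simp: s mod_2_eq_iff)
        next
          case A: 2
          define s where "s = 2 * (n div 4) + 1"
          have s: "n = 2 * s + 1" "odd s" using A div_mult_mod_eq[of n 4] by (auto simp: s_def)
          then have "s \<ge> 7" using n by presburger
          moreover have "D_set s \<subseteq> comm_spectrum s" "D_set (s - 1) \<subseteq> comm_spectrum (s - 1)"
            using less.IH[of s] less.IH[of "s - 1"] s \<open>s \<ge> 7\<close> by simp_all
          ultimately show ?thesis
            using range_3_mod_4[of s k] 2 s(2) by (simp add: s(1) odd_iff_mod_2_eq_one)
        next
          case A: 3
          define s where "s = 2 * (n div 4) - 1"
          have "n div 4 \<ge> 4" using A n by presburger
          then have s: "n = 2 * s + 3" "odd s" "s \<ge> 7"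
            using A div_mult_mod_eq[of n 4] by (auto simp: s_def)
          then have "D_set s \<subseteq> comm_spectrum s" "D_set (s + 1) \<subseteq> comm_spectrum (s + 1)"
            using less.IH[of s] less.IH[of "s + 1"] by simp_all
          then show ?thesis
            using range_1_mod_4[of s k] 2 s(2,3) by (simp add: s(1) odd_iff_mod_2_eq_one)
        qed
      qed
    qed
  qed (rule small)
qed

theorem theorem1p2:
  fixes n :: nat
  assumes "n > 0"
  shows "(n = 4 \<longrightarrow> comm_spectrum n = D_set n - {10}) \<and>
         (n = 5 \<longrightarrow> comm_spectrum n = D_set n - {17}) \<and>
         (n \<notin> {4, 5} \<longrightarrow> comm_spectrum n = D_set n)"
proof (intro conjI impI)
  note upper = comm_spectrum_upper[OF assms]
  show "comm_spectrum n = D_set n - {10}" if "n = 4"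
  proof
    have "D_set 4 - {10} \<subseteq> set [4, 6, 8, 16]" unfolding D_set_list by code_simp
    then show "D_set n - {10} \<subseteq> comm_spectrum n" using tables_subset(2) that by blast
  qed (use upper that in blast)
  show "comm_spectrum n = D_set n - {17}" if "n = 5"
  proof
    have "D_set 5 - {17} \<subseteq> set [5, 7, 9, 11, 13, 15, 19, 25]" unfolding D_set_list by code_simp
    then show "D_set n - {17} \<subseteq> comm_spectrum n" using tables_subset(3) that by blast
  qed (use upper that in blast)
  show "comm_spectrum n = D_set n" if "n \<notin> {4, 5}"
  proof
    show "D_set n \<subseteq> comm_spectrum n"
    proof (cases "n \<ge> 6")
      case True
      then show ?thesis by (rule D_set_subset)
    next
      case False
      with assms that have "n = 1 \<or> n = 2 \<or> n = 3" by auto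
      moreover have "D_set 1 \<subseteq> {1\<^sup>2}" "D_set 2 \<subseteq> {2\<^sup>2}" "D_set 3 \<subseteq> {3, 3\<^sup>2}"
        unfolding D_set_list by code_simp+
      ultimately show ?thesis
        using tables_subset(1) square_in_spectrum[of n] by auto
    qed
  qed (use upper in blast)
qed

end
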